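(* Let $\chi,\mu$ be probability measures on $\mathbb{R}$, $\ddot\mu$ a symmetrization of $\mu$, and $\mathfrak{D}(\cdot,m)$ the associated deconvolution function. Put $\mathcal{P}_{\ddot\mu}(t,m):=(1-\Phi_{\ddot\mu}(t))^{m+1}$, $m\ge0$. Assume that $\Phi_{\ddot\mu}(\infty):=\lim_{t\to\infty}\Phi_{\ddot\mu}(t)$ exists and that $\sup_{m\ge0}|\mathcal{P}_{\ddot\mu}|([0,\infty],m)<\infty$, where $|\mathcal{P}_{\ddot\mu}|([0,\infty],m)$ is the variation of $\mathcal{P}_{\ddot\mu}(\cdot,m)$ on $[0,\infty]$. Assume in addition that there exist $K\in\mathbb{N}$ and $\tau_1,\dots,\tau_{2K}\in\mathcal{N}_\mu\cap[0,\infty]$ with $\tau_k\le\tau_{k+1}$ and $[\tau_k,\tau_{k+1}]\subseteq\mathcal{N}_\mu$ for odd $k\in\{1,\dots,2K\}$, $\tau_k<\tau_{k+1}$ for even $k<2K$, and $\mathcal{N}_\mu\cap[0,\infty]=\bigcup_{k=1}^K[\tau_{2k-1},\tau_{2k}]$. Then, for every $\xi\in\mathbb{R}$, $$\lim_{m\to\infty}\frac{\mathfrak{D}(\xi,m)+\mathfrak{D}(\xi-,m)}{2}=\frac{F_\chi(\xi)+F_\chi(\xi-)}{2}+\sum_{k=1}^K\mathcal{F}\{\Psi_{\tau_{2k-1},\tau_{2k}}\}(-\xi).$$ The sum equals zero if $\mathcal{N}_\mu$ has Lebesgue measure zero.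
   Context: Measures are finite signed Borel measures on $\mathbb{R}$. $F_\nu(\xi) := \nu((-\infty,\xi])$, $\Phi_\nu(t) := \int e^{itx}\,\nu(dx)$, and $\mathcal{N}_\nu := \{t \in \mathbb{R}\cup\{\pm\infty\} : \Phi_\nu(t)=0\}$, where $\pm\infty \in \mathcal{N}_\nu$ means $\lim_{t\to\pm\infty}\Phi_\nu(t)=0$. $Q(\xi-)$ denotes the left limit. $\nu^{*0}:=\delta_{\{0\}}$, $\nu^{*k} := \nu * \nu^{*(k-1)}$, and $F_\nu^{*k}$ is the distribution function of $\nu^{*k}$. A symmetrization of $\mu$ is a probability measure $\ddot\mu = \mu*\eta$, with $\eta$ a probability measure, such that $F_{\ddot\mu}(\xi-)=1-F_{\ddot\mu}(-\xi)$ for all $\xi$, $\Phi_{\ddot\mu}=\Phi_\mu\Phi_\eta$ is even with $0\le\Phi_{\ddot\mu}\le1$, and $\mathcal{N}_{\ddot\mu}=\mathcal{N}_\mu$. Put $\pi_{\ddot\mu} := \delta_{\{0\}} - \ddot\mu$, $\mathfrak{K}_{\ddot\mu}(\xi,m) := \sum_{\ell=0}^m F_{\pi_{\ddot\mu}}^{*\ell}(\xi)$. The deconvolution function is $\mathfrak{D}(\xi,m) := \int_{\mathbb{R}} F_{\chi*\ddot\mu}(\xi-x)\,\mathfrak{K}_{\ddot\mu}(dx,m)$, for $(\xi,m)\in\mathbb{R}\times\mathbb{N}_0$. For $0<S\le T\le\infty$, $\mathcal{F}\{\Psi_{S,T}\}(-\xi)$ denotes the (for $T=\infty$ improper) integral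 $\int_{S\le|t|\le T}e^{-i\xi t}\frac{\Phi_\chi(t)}{2\pi it}\,dt$, which equals $$-\frac1\pi\int_{-\infty}^\infty\{\operatorname{Si}((\xi-x)T)-\operatorname{Si}((\xi-x)S)\}\,F_\chi(dx),\qquad\operatorname{Si}(y):=\int_0^y\frac{\sin t}{t}\,dt,$$ with $\operatorname{Si}((\xi-x)\cdot\infty)$ read as $\frac\pi2\operatorname{sgn}(\xi-x)$ (so that the value is $0$ if $S=T$, including $S=T=\infty$). *)

theory Defs
  imports "HOL-Probability.Probability"
begin

text \<open>
  A finite signed Borel measure on the real line is represented by its set function
  \<open>\<nu> :: real set \<Rightarrow> real\<close>, of which only the values on Borel sets matter. Integration against
  \<open>\<nu>\<close> goes through the Jordan decomposition.
\<close>

type_synonym signed_borel = "real set \<Rightarrow> real"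

definition positive_part :: "signed_borel \<Rightarrow> real measure" where
  "positive_part \<nu> =
     measure_of UNIV (sets borel) (\<lambda>A. SUP B\<in>{B \<in> sets borel. B \<subseteq> A}. ennreal (\<nu> B))"

definition negative_part :: "signed_borel \<Rightarrow> real measure" where
  "negative_part \<nu> = positive_part (\<lambda>A. - \<nu> A)"

definition signed_integral :: "signed_borel \<Rightarrow> (real \<Rightarrow> real) \<Rightarrow> real" where
  "signed_integral \<nu> f =
     (LINT x|positive_part \<nu>. f x) - (LINT x|negative_part \<nu>. f x)"

definition signed_cdf :: "signed_borel \<Rightarrow> real \<Rightarrow> real" where
  "signed_cdf \<nu> \<xi> = \<nu> {..\<xi>}"

definition signed_convolution :: "signed_borel \<Rightarrow> signed_borel \<Rightarrow> signed_borel" where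
  "signed_convolution \<nu> \<rho> = (\<lambda>A. signed_integral \<nu> (\<lambda>x. \<rho> {y. x + y \<in> A}))"

fun convolution_power :: "signed_borel \<Rightarrow> nat \<Rightarrow> signed_borel" where
  "convolution_power \<nu> 0 = measure (return borel 0)"
| "convolution_power \<nu> (Suc k) = signed_convolution \<nu> (convolution_power \<nu> k)"

definition left_limit :: "(real \<Rightarrow> real) \<Rightarrow> real \<Rightarrow> real" where
  "left_limit Q \<xi> = Lim (at_left \<xi>) Q"

definition char_zeros :: "real measure \<Rightarrow> ereal set" where
  "char_zeros M = {t. case t of
       ereal r \<Rightarrow> char M r = 0
     | PInfty \<Rightarrow> (char M \<longlongrightarrow> 0) at_top
     | MInfty \<Rightarrow> (char M \<longlongrightarrow> 0) at_bot}"

text \<open>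
  \<open>symmetrization \<mu> \<mu>'\<close>: the measure \<open>\<mu>'\<close> is a symmetrization of \<open>\<mu>\<close>. The library's
  characteristic function is complex-valued, so \<open>0 \<le> \<Phi> \<le> 1\<close> includes that \<open>\<Phi>\<close> is real.
\<close>

definition symmetrization :: "real measure \<Rightarrow> real measure \<Rightarrow> bool" where
  "symmetrization \<mu> \<mu>' \<longleftrightarrow>
     (\<exists>\<eta>. real_distribution \<eta> \<and> \<mu>' = (\<mu> \<star> \<eta>) \<and>
       (\<forall>t. char \<mu>' t = char \<mu> t * char \<eta> t)) \<and>
     real_distribution \<mu>' \<and>
     (\<forall>\<xi>. left_limit (cdf \<mu>') \<xi> = 1 - cdf \<mu>' (- \<xi>)) \<and>
     (\<forall>t. char \<mu>' (- t) = char \<mu>' t) \<and>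
     (\<forall>t. char \<mu>' t \<in> \<real> \<and> 0 \<le> Re (char \<mu>' t) \<and> Re (char \<mu>' t) \<le> 1) \<and>
     char_zeros \<mu>' = char_zeros \<mu>"

definition dirac_minus :: "real measure \<Rightarrow> signed_borel" where
  "dirac_minus M = (\<lambda>A. measure (return borel 0) A - measure M A)"

definition decon_kernel :: "real measure \<Rightarrow> real \<Rightarrow> nat \<Rightarrow> real" where
  "decon_kernel M \<xi> m = (\<Sum>l\<le>m. signed_cdf (convolution_power (dirac_minus M) l) \<xi>)"

text \<open>
  The signed measure \<open>decon_kernel M (dx) m\<close>, that is, the one whose distribution function
  is \<open>\<lambda>\<xi>. decon_kernel M \<xi> m\<close>.
\<close>

definition decon_kernel_measure :: "real measure \<Rightarrow> nat \<Rightarrow> signed_borel" where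
  "decon_kernel_measure M m = (\<lambda>A. \<Sum>l\<le>m. convolution_power (dirac_minus M) l A)"

lemma signed_cdf_decon_kernel_measure:
  "signed_cdf (decon_kernel_measure M m) \<xi> = decon_kernel M \<xi> m"
  by (simp add: signed_cdf_def decon_kernel_measure_def decon_kernel_def)

definition deconvolution :: "real measure \<Rightarrow> real measure \<Rightarrow> real \<Rightarrow> nat \<Rightarrow> real" where
  "deconvolution chi M \<xi> m =
     signed_integral (decon_kernel_measure M m) (\<lambda>x. cdf (chi \<star> M) (\<xi> - x))"

definition char_ext :: "real measure \<Rightarrow> ereal \<Rightarrow> complex" where
  "char_ext M t = (case t of
       ereal r \<Rightarrow> char M r
     | PInfty \<Rightarrow> Lim at_top (char M)
     | MInfty \<Rightarrow> Lim at_bot (char M))"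

definition decon_power :: "real measure \<Rightarrow> ereal \<Rightarrow> nat \<Rightarrow> complex" where
  "decon_power M t m = (1 - char_ext M t) ^ (m + 1)"

text \<open>
  Total variation of \<open>f\<close> on \<open>A\<close>: the supremum over all finite increasing sequences of points
  of \<open>A\<close>, here given as sorted lists (repeated points contribute zero).
\<close>

definition variation_on :: "('a::linorder \<Rightarrow> 'b::real_normed_vector) \<Rightarrow> 'a set \<Rightarrow> ennreal" where
  "variation_on f A =
     (SUP ts\<in>{ts. sorted ts \<and> set ts \<subseteq> A}.
        \<Sum>i<length ts - 1. ennreal (norm (f (ts ! Suc i) - f (ts ! i))))"

text \<open>
  \<open>fourier_Psi chi S T y\<close> is the Fourier integral at \<open>y\<close> of
  \<open>\<Psi>(t) = char chi t / (2 \<pi> i t)\<close> restricted to \<open>S \<le> \<bar>t\<bar> \<le> T\<close>. For \<open>T = \<infinity>\<close> the integral is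
  improper in the symmetric sense: the two half-lines need not have separate limits (if
  \<open>chi\<close> has an atom at \<open>-y\<close>, each of them diverges logarithmically). For \<open>S = T = \<infinity>\<close> the
  domains of integration are empty.
\<close>

definition truncated_fourier_Psi ::
    "real measure \<Rightarrow> ereal \<Rightarrow> ereal \<Rightarrow> real \<Rightarrow> complex" where
  "truncated_fourier_Psi chi S R y =
     (CLBINT t:{t. S \<le> ereal \<bar>t\<bar> \<and> ereal \<bar>t\<bar> \<le> R}.
        exp (\<i> * of_real (y * t)) * (char chi t / (2 * of_real pi * \<i> * of_real t)))"

definition fourier_Psi :: "real measure \<Rightarrow> ereal \<Rightarrow> ereal \<Rightarrow> real \<Rightarrow> complex" where
  "fourier_Psi chi S T y =
     (if T = \<infinity> then Lim at_top (\<lambda>R::real. truncated_fourier_Psi chi S (ereal R) y)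
      else truncated_fourier_Psi chi S T y)"

end

theory Submission
  imports Defs
begin

text \<open>
  Write \<open>\<Phi>\<close> for the characteristic function of the symmetrization \<open>\<mu>'\<close>, which is real, and let
  \<open>\<pi> = \<delta> - \<mu>'\<close>. Since \<open>\<mu>' = \<delta> - \<pi>\<close>, the sum in the deconvolution kernel telescopes, and
  \<open>deconvolution chi \<mu>' \<xi> m\<close> equals \<open>cdf chi \<xi>\<close> minus the distribution function at \<open>\<xi>\<close> of \<open>chi\<close>
  convolved with the power \<open>m + 1\<close> of \<open>\<pi>\<close> (\<open>deconvolution_telescope\<close>). The midpoint of that last
  distribution function is the integral over \<open>chi (dz)\<close> of half the integral of
  \<open>sgn (\<xi> - z - x)\<close> over this power (\<open>deconvolution_midpoint\<close>). The Fourier transform of the power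
  is \<open>(1 - \<Phi>) ^ (m + 1)\<close>, and an inversion formula (\<open>signed_integral_sgn_inversion\<close>) identifies
  half the sign integral at \<open>w = \<xi> - z\<close> with the improper integral of
  \<open>sin (t w) / (pi t) * (1 - \<Phi> t) ^ (m + 1)\<close> over \<open>t > 0\<close>.

  As \<open>m\<close> grows, the power of \<open>1 - \<Phi>\<close> tends to the indicator of the zero set of \<open>\<Phi>\<close>. On a compact
  interval of positive \<open>t\<close> dominated convergence suffices. For the remaining parts near \<open>0\<close> and
  \<open>\<infinity>\<close>, Abel summation bounds the integral by the oscillation of the sine integral \<open>Si\<close> times one plus
  the variation of \<open>(1 - \<Phi>) ^ (m + 1)\<close> (\<open>Abel_summation_bounded_variation\<close>). This variation is
  bounded uniformly in \<open>m\<close>, so the limits in \<open>m\<close> and in the cut-off may be interchanged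
  (\<open>swap_uniformly_Cauchy_limits\<close>). The same bound dominates the inner integrals uniformly in \<open>z\<close>
  and \<open>m\<close>, which permits the passage to the limit under the integral over \<open>chi\<close>.

  The zero set in \<open>(0, \<infinity>)\<close> is a disjoint union of intervals, and integrating \<open>sin (t w) / t\<close> over one
  of them gives a difference of values of \<open>Si\<close>. Integrated over \<open>chi\<close>, this is up to the factor
  \<open>- 1 / pi\<close> the Fourier integral \<open>fourier_Psi\<close> (\<open>fourier_Psi_Si_ext\<close>). If the zero set is a null
  set, all its intervals are points and every difference vanishes.

  The signed measures enter only through integrals of bounded Borel functions. Every signed measure
  that occurs is an explicit difference of two finite measures, and the integral defined by the
  Jordan decomposition can be computed from any such difference
  (\<open>signed_integral_measure_difference\<close>).
\<close>

section \<open>Signed measures as differences of finite measures\<close>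

definition plus_measure :: "real measure \<Rightarrow> real measure \<Rightarrow> real measure" where
  "plus_measure M N = measure_of UNIV (sets borel) (\<lambda>A. emeasure M A + emeasure N A)"

lemma sets_plus_measure [simp, measurable_cong]: "sets (plus_measure M N) = sets borel"
  by (simp add: plus_measure_def sets.sigma_sets_eq[of borel, simplified])

lemma space_plus_measure [simp]: "space (plus_measure M N) = UNIV"
  by (simp add: plus_measure_def)

lemma emeasure_plus_measure:
  assumes "sets M = sets borel" "sets N = sets borel" "A \<in> sets borel"
  shows "emeasure (plus_measure M N) A = emeasure M A + emeasure N A"
  unfolding plus_measure_def
proof (rule emeasure_measure_of_sigma)
  show "sigma_algebra (UNIV::real set) (sets borel)"
    using sets.sigma_algebra_axioms[of "borel :: real measure"] by simp
  show "countably_additive (sets borel) (\<lambda>A. emeasure M A + emeasure N A)"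
    unfolding countably_additive_def
    using assms by (auto simp: suminf_add[OF summableI summableI, symmetric] suminf_emeasure)
qed (use assms in \<open>auto simp: positive_def\<close>)

lemma nn_integral_plus_measure:
  assumes M: "sets M = sets borel" and N: "sets N = sets borel"
    and f: "f \<in> borel_measurable borel"
  shows "(\<integral>\<^sup>+x. f x \<partial>plus_measure M N) = (\<integral>\<^sup>+x. f x \<partial>M) + (\<integral>\<^sup>+x. f x \<partial>N)"
proof -
  note [measurable_cong] = M N
  have [simp]: "space M = UNIV" "space N = UNIV"
    using M N sets_eq_imp_space_eq[of _ "borel::real measure"] by auto
  show ?thesis
    using f
  proof (induction f rule: borel_measurable_induct)
    case (set A)
    then show ?case using M N by (simp add: emeasure_plus_measure)
  next
    case (mult u c)
    then show ?case by (simp add: nn_integral_cmult distrib_left)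
  next
    case (add u v)
    then show ?case by (simp add: nn_integral_add ac_simps)
  next
    case (seq U)
    have m: "\<And>i. U i \<in> borel_measurable borel" by fact
    have inc: "incseq (\<lambda>i. \<integral>\<^sup>+x. U i x \<partial>L)" for L :: "real measure"
      using \<open>incseq U\<close> by (auto simp: incseq_def le_fun_def intro!: nn_integral_mono)
    have sup: "(\<integral>\<^sup>+x. (SUP i. U i x) \<partial>L) = (SUP i. \<integral>\<^sup>+x. U i x \<partial>L)"
      if L: "sets L = sets borel" for L
      using \<open>incseq U\<close> m measurable_cong_sets[OF L refl, of borel]
      by (intro nn_integral_monotone_convergence_SUP) auto
    have "(\<integral>\<^sup>+x. (SUP i. U i x) \<partial>plus_measure M N) =
        (SUP i. (\<integral>\<^sup>+x. U i x \<partial>M) + (\<integral>\<^sup>+x. U i x \<partial>N))"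
      by (simp only: sup sets_plus_measure seq.IH)
    also have "\<dots> = (SUP i. \<integral>\<^sup>+x. U i x \<partial>M) + (SUP i. \<integral>\<^sup>+x. U i x \<partial>N)"
      by (rule ennreal_SUP_add[OF inc inc])
    finally show ?case
      by (simp only: sup M N SUP_apply)
  next
    case (cong f g)
    then have "(\<integral>\<^sup>+x. f x \<partial>L) = (\<integral>\<^sup>+x. g x \<partial>L)" for L :: "real measure"
      by (intro nn_integral_cong) auto
    with cong show ?case by (simp only:)
  qed
qed

lemma (in finite_borel_measure) integrable_bounded:
  fixes f :: "real \<Rightarrow> 'b::{banach, second_countable_topology}"
  assumes "f \<in> borel_measurable borel" "\<And>x. norm (f x) \<le> B"
  shows "integrable M f"
proof (rule integrable_const_bound[where B = B])
  show "f \<in> borel_measurable M"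
    using assms(1) by (simp only: measurable_cong_sets[OF M_is_borel refl])
  show "AE x in M. norm (f x) \<le> B"
    by (intro AE_I2 assms(2))
qed

lemma finite_borel_measure_plus:
  assumes "finite_borel_measure M" "finite_borel_measure N"
  shows "finite_borel_measure (plus_measure M N)"
proof -
  interpret M: finite_borel_measure M by fact
  interpret N: finite_borel_measure N by fact
  show ?thesis
  proof (intro finite_borel_measure.intro finite_measureI finite_borel_measure_axioms.intro)
    have UNIV_borel: "(UNIV :: real set) \<in> sets borel" by simp
    have "emeasure M UNIV + emeasure N UNIV \<noteq> \<infinity>"
      using M.emeasure_finite[of UNIV] N.emeasure_finite[of UNIV] by simp
    then show "emeasure (plus_measure M N) (space (plus_measure M N)) \<noteq> \<infinity>"
      unfolding space_plus_measure emeasure_plus_measure[OF M.M_is_borel N.M_is_borel UNIV_borel] .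
  qed (rule sets_plus_measure)
qed

lemma measure_plus_measure:
  assumes "finite_borel_measure M" "finite_borel_measure N" "A \<in> sets borel"
  shows "measure (plus_measure M N) A = measure M A + measure N A"
proof -
  interpret M: finite_borel_measure M by fact
  interpret N: finite_borel_measure N by fact
  show ?thesis
    unfolding measure_def emeasure_plus_measure[OF M.M_is_borel N.M_is_borel assms(3)]
    using M.emeasure_finite[of A] N.emeasure_finite[of A]
    by (intro enn2real_plus) (simp_all only: less_top infinity_ennreal_def)
qed

lemma integral_plus_measure:
  fixes f :: "real \<Rightarrow> real"
  assumes "finite_borel_measure M" "finite_borel_measure N"
    and f: "f \<in> borel_measurable borel" "\<And>x. \<bar>f x\<bar> \<le> B"
  shows "(LINT x|plus_measure M N. f x) = (LINT x|M. f x) + (LINT x|N. f x)"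
proof -
  interpret M: finite_borel_measure M by fact
  interpret N: finite_borel_measure N by fact
  interpret P: finite_borel_measure "plus_measure M N"
    using assms by (intro finite_borel_measure_plus)
  have i: "integrable M f" "integrable N f" "integrable (plus_measure M N) f"
    using f by (auto intro!: M.integrable_bounded N.integrable_bounded P.integrable_bounded)
  have fin: "(\<integral>\<^sup>+x. ennreal (f x) \<partial>L) < \<top>" "(\<integral>\<^sup>+x. ennreal (- f x) \<partial>L) < \<top>"
    if "integrable L f" for L
    using that by (auto simp: real_integrable_def less_top)
  have m: "(\<lambda>x. ennreal (f x)) \<in> borel_measurable borel" "(\<lambda>x. ennreal (- f x)) \<in> borel_measurable borel"
    using f by auto
  have "enn2real (\<integral>\<^sup>+x. ennreal (f x) \<partial>plus_measure M N) =
      enn2real (\<integral>\<^sup>+x. ennreal (f x) \<partial>M) + enn2real (\<integral>\<^sup>+x. ennreal (f x) \<partial>N)"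
    by (simp only: nn_integral_plus_measure[OF M.M_is_borel N.M_is_borel m(1)]
        enn2real_plus[OF fin(1)[OF i(1)] fin(1)[OF i(2)]])
  moreover have "enn2real (\<integral>\<^sup>+x. ennreal (- f x) \<partial>plus_measure M N) =
      enn2real (\<integral>\<^sup>+x. ennreal (- f x) \<partial>M) + enn2real (\<integral>\<^sup>+x. ennreal (- f x) \<partial>N)"
    by (simp only: nn_integral_plus_measure[OF M.M_is_borel N.M_is_borel m(2)]
        enn2real_plus[OF fin(2)[OF i(1)] fin(2)[OF i(2)]])
  ultimately show ?thesis
    by (simp only: real_lebesgue_integral_def[OF i(1)] real_lebesgue_integral_def[OF i(2)]
        real_lebesgue_integral_def[OF i(3)] add_diff_add)
qed

definition measure_difference :: "signed_borel \<Rightarrow> real measure \<Rightarrow> real measure \<Rightarrow> bool" where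
  "measure_difference \<nu> M N \<longleftrightarrow> finite_borel_measure M \<and> finite_borel_measure N \<and>
     (\<forall>A\<in>sets borel. \<nu> A = measure M A - measure N A)"

lemma measure_differenceD:
  assumes "measure_difference \<nu> M N"
  shows "finite_borel_measure M" "finite_borel_measure N"
    and "A \<in> sets borel \<Longrightarrow> \<nu> A = measure M A - measure N A"
  using assms by (simp_all add: measure_difference_def)

text \<open>
  The representation of a signed measure as a difference is not unique, but
  \<open>M - N = M' - N'\<close> means \<open>M + N' = M' + N\<close>, an equality of measures, and integrals of bounded
  functions are additive in the measure.
\<close>
lemma integral_difference_unique:
  fixes f :: "real \<Rightarrow> real"
  assumes "measure_difference \<nu> M N" "measure_difference \<nu> M' N'"
    and f: "f \<in> borel_measurable borel" "\<And>x. \<bar>f x\<bar> \<le> B"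
  shows "(LINT x|M. f x) - (LINT x|N. f x) = (LINT x|M'. f x) - (LINT x|N'. f x)"
proof -
  have fin: "finite_borel_measure M" "finite_borel_measure N"
      "finite_borel_measure M'" "finite_borel_measure N'"
    by (rule measure_differenceD(1,2)[OF assms(1)] measure_differenceD(1,2)[OF assms(2)])+
  have eq: "measure M A + measure N' A = measure M' A + measure N A" if "A \<in> sets borel" for A
  proof -
    have "\<nu> A = measure M A - measure N A" "\<nu> A = measure M' A - measure N' A"
      by (rule measure_differenceD(3)[OF assms(1) that] measure_differenceD(3)[OF assms(2) that])+
    then show ?thesis by linarith
  qed
  have "plus_measure M N' = plus_measure M' N"
  proof (rule measure_eqI)
    fix A assume "A \<in> sets (plus_measure M N')"
    then have A: "A \<in> sets borel" by simp
    interpret P: finite_borel_measure "plus_measure M N'" by (intro finite_borel_measure_plus fin)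
    interpret Q: finite_borel_measure "plus_measure M' N" by (intro finite_borel_measure_plus fin)
    show "emeasure (plus_measure M N') A = emeasure (plus_measure M' N) A"
      using A eq by (simp add: P.emeasure_eq_measure Q.emeasure_eq_measure measure_plus_measure fin)
  qed simp
  then have "(LINT x|plus_measure M N'. f x) = (LINT x|plus_measure M' N. f x)"
    by simp
  then show ?thesis
    using integral_plus_measure[OF fin(1,4) f] integral_plus_measure[OF fin(3,2) f] by simp
qed

text \<open>
  Let \<open>Y\<close> be a positive set of a Hahn decomposition. Passing from a subset \<open>B\<close> of \<open>A\<close> to
  \<open>B \<inter> Y\<close> discards only nonpositive mass, and passing from there to \<open>A \<inter> Y\<close> adds only nonnegative
  mass. So the supremum that defines the positive part is attained at \<open>A \<inter> Y\<close>, which makes the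
  supremum countably additive in \<open>A\<close>; without this, \<open>measure_of\<close> would return the zero measure.
\<close>
lemma emeasure_positive_part:
  assumes \<nu>: "measure_difference \<nu> M N" and Y: "Y \<in> sets borel"
    and pos: "\<And>X. X \<in> sets borel \<Longrightarrow> X \<subseteq> Y \<Longrightarrow> 0 \<le> \<nu> X"
    and neg: "\<And>X. X \<in> sets borel \<Longrightarrow> X \<inter> Y = {} \<Longrightarrow> \<nu> X \<le> 0"
    and A: "A \<in> sets borel"
  shows "emeasure (positive_part \<nu>) A = ennreal (\<nu> (A \<inter> Y))"
proof -
  interpret M: finite_borel_measure M by (rule measure_differenceD(1)[OF \<nu>])
  interpret N: finite_borel_measure N by (rule measure_differenceD(2)[OF \<nu>])
  have \<nu>_eq: "\<nu> B = measure M B - measure N B" if "B \<in> sets borel" for B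
    by (rule measure_differenceD(3)[OF \<nu> that])
  have add: "\<nu> (B \<union> C) = \<nu> B + \<nu> C" if "B \<in> sets borel" "C \<in> sets borel" "B \<inter> C = {}" for B C
    using that M.finite_measure_Union[of B C] N.finite_measure_Union[of B C]
    by (simp add: \<nu>_eq M.M_is_borel N.M_is_borel)
  have sup: "(SUP B\<in>{B \<in> sets borel. B \<subseteq> A}. ennreal (\<nu> B)) = ennreal (\<nu> (A \<inter> Y))"
    if A: "A \<in> sets borel" for A
  proof (rule antisym)
    show "(SUP B\<in>{B \<in> sets borel. B \<subseteq> A}. ennreal (\<nu> B)) \<le> ennreal (\<nu> (A \<inter> Y))"
    proof (rule SUP_least)
      fix B assume "B \<in> {B \<in> sets borel. B \<subseteq> A}"
      then have B: "B \<in> sets borel" "B \<subseteq> A" by auto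
      have "\<nu> B = \<nu> (B \<inter> Y) + \<nu> (B - Y)"
        using B Y by (subst add[symmetric]) (auto intro!: arg_cong[where f = \<nu>])
      also have "\<dots> \<le> \<nu> (B \<inter> Y) + \<nu> ((A - B) \<inter> Y)"
        using neg[of "B - Y"] pos[of "(A - B) \<inter> Y"] A B Y
        by (smt (verit) Diff_disjoint Int_commute Int_lower2 sets.Diff sets.Int)
      also have "\<dots> = \<nu> (A \<inter> Y)"
        using A B Y by (subst add[symmetric]) (auto intro!: arg_cong[where f = \<nu>])
      finally show "ennreal (\<nu> B) \<le> ennreal (\<nu> (A \<inter> Y))" by (rule ennreal_leI)
    qed
    show "ennreal (\<nu> (A \<inter> Y)) \<le> (SUP B\<in>{B \<in> sets borel. B \<subseteq> A}. ennreal (\<nu> B))"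
      using A Y by (intro SUP_upper) auto
  qed
  have "emeasure (positive_part \<nu>) A = (SUP B\<in>{B \<in> sets borel. B \<subseteq> A}. ennreal (\<nu> B))"
    unfolding positive_part_def
  proof (rule emeasure_measure_of_sigma[OF _ _ _ A])
    show "sigma_algebra (UNIV::real set) (sets borel)"
      using sets.sigma_algebra_axioms[of "borel :: real measure"] by simp
    show "positive (sets borel) (\<lambda>A. SUP B\<in>{B \<in> sets borel. B \<subseteq> A}. ennreal (\<nu> B))"
      using sup[of "{}"] \<nu>_eq[of "{}"] by (simp add: positive_def)
    show "countably_additive (sets borel) (\<lambda>A. SUP B\<in>{B \<in> sets borel. B \<subseteq> A}. ennreal (\<nu> B))"
      unfolding countably_additive_def
    proof safe
      fix C :: "nat \<Rightarrow> real set"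
      assume C: "range C \<subseteq> sets borel" "disjoint_family C" "\<Union> (range C) \<in> sets borel"
      have C': "range (\<lambda>i. C i \<inter> Y) \<subseteq> sets borel" "disjoint_family (\<lambda>i. C i \<inter> Y)"
        using C Y by (auto simp: disjoint_family_on_def)
      have "(\<lambda>i. measure M (C i \<inter> Y) - measure N (C i \<inter> Y)) sums
          (measure M (\<Union>i. C i \<inter> Y) - measure N (\<Union>i. C i \<inter> Y))"
        using C' by (intro sums_diff M.finite_measure_UNION N.finite_measure_UNION)
          (auto simp: M.M_is_borel N.M_is_borel)
      moreover have "measure M (C i \<inter> Y) - measure N (C i \<inter> Y) = \<nu> (C i \<inter> Y)" for i
        using C' by (subst \<nu>_eq) auto
      moreover have "measure M (\<Union>i. C i \<inter> Y) - measure N (\<Union>i. C i \<inter> Y) = \<nu> (\<Union> (range C) \<inter> Y)"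
        using C Y by (subst \<nu>_eq) (auto simp: Int_UN_distrib2)
      ultimately have "(\<lambda>i. \<nu> (C i \<inter> Y)) sums \<nu> (\<Union> (range C) \<inter> Y)" by simp
      moreover have "0 \<le> \<nu> (C i \<inter> Y)" for i
        using C' by (intro pos) auto
      ultimately have "(\<Sum>i. ennreal (\<nu> (C i \<inter> Y))) = ennreal (\<nu> (\<Union> (range C) \<inter> Y))"
        by (intro suminf_ennreal_eq)
      moreover have "(SUP B\<in>{B \<in> sets borel. B \<subseteq> C i}. ennreal (\<nu> B)) = ennreal (\<nu> (C i \<inter> Y))" for i
        using C by (intro sup) auto
      ultimately show "(\<Sum>i. SUP B\<in>{B \<in> sets borel. B \<subseteq> C i}. ennreal (\<nu> B)) =
          (SUP B\<in>{B \<in> sets borel. B \<subseteq> \<Union> (range C)}. ennreal (\<nu> B))"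
        using sup[OF C(3)] by simp
    qed
  qed
  with sup[OF A] show ?thesis by simp
qed

lemma measure_difference_Jordan:
  assumes \<nu>: "measure_difference \<nu> M N"
  shows "measure_difference \<nu> (positive_part \<nu>) (negative_part \<nu>)"
proof -
  interpret M: finite_borel_measure M by (rule measure_differenceD(1)[OF \<nu>])
  interpret N: finite_borel_measure N by (rule measure_differenceD(2)[OF \<nu>])
  have \<nu>_eq: "\<nu> B = measure M B - measure N B" if "B \<in> sets borel" for B
    by (rule measure_differenceD(3)[OF \<nu> that])
  have fin: "finite_measure M" "finite_measure N" "sets N = sets M"
    using M.finite_measure_axioms N.finite_measure_axioms unfolding M.M_is_borel N.M_is_borel by simp_all
  obtain Y where Y: "Y \<in> sets borel"
    and le: "\<And>X. X \<in> sets borel \<Longrightarrow> X \<subseteq> Y \<Longrightarrow> emeasure N X \<le> emeasure M X"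
      "\<And>X. X \<in> sets borel \<Longrightarrow> X \<inter> Y = {} \<Longrightarrow> emeasure M X \<le> emeasure N X"
    using finite_unsigned_Hahn_decomposition[OF fin] unfolding M.M_is_borel by metis
  have pos: "0 \<le> \<nu> X" if "X \<in> sets borel" "X \<subseteq> Y" for X
    using le(1)[OF that]
    by (simp only: \<nu>_eq[OF that(1)] M.emeasure_eq_measure N.emeasure_eq_measure
        ennreal_le_iff[OF measure_nonneg] diff_ge_0_iff_ge)
  have neg: "\<nu> X \<le> 0" if "X \<in> sets borel" "X \<inter> Y = {}" for X
    using le(2)[OF that]
    by (simp only: \<nu>_eq[OF that(1)] M.emeasure_eq_measure N.emeasure_eq_measure
        ennreal_le_iff[OF measure_nonneg] diff_le_0_iff_le)
  have \<nu>': "measure_difference (\<lambda>A. - \<nu> A) N M"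
    unfolding measure_difference_def
    by (intro conjI ballI N.finite_borel_measure_axioms M.finite_borel_measure_axioms)
      (simp only: \<nu>_eq minus_diff_eq)
  have P: "emeasure (positive_part \<nu>) A = ennreal (\<nu> (A \<inter> Y))" if "A \<in> sets borel" for A
    by (rule emeasure_positive_part[OF \<nu> Y pos neg that])
  have Q: "emeasure (negative_part \<nu>) A = ennreal (- \<nu> (A \<inter> - Y))" if "A \<in> sets borel" for A
    unfolding negative_part_def
  proof (rule emeasure_positive_part[OF \<nu>' _ _ _ that])
    show "0 \<le> - \<nu> X" if "X \<in> sets borel" "X \<subseteq> - Y" for X
      using neg[of X] that by auto
    show "- \<nu> X \<le> 0" if "X \<in> sets borel" "X \<inter> - Y = {}" for X
      using pos[of X] that by auto
  qed (use Y in auto)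
  have sets: "sets (positive_part \<nu>) = sets borel" "sets (negative_part \<nu>) = sets borel"
    by (simp_all add: negative_part_def positive_part_def sets.sigma_sets_eq[of borel, simplified])
  have sp: "space (positive_part \<nu>) = UNIV" "space (negative_part \<nu>) = UNIV"
    by (simp_all add: negative_part_def positive_part_def)
  have "finite_borel_measure (positive_part \<nu>)"
    by (intro finite_borel_measure.intro finite_measureI finite_borel_measure_axioms.intro)
      (simp_all add: sets sp P)
  moreover have "finite_borel_measure (negative_part \<nu>)"
    by (intro finite_borel_measure.intro finite_measureI finite_borel_measure_axioms.intro)
      (simp_all add: sets sp Q)
  moreover have "\<nu> A = measure (positive_part \<nu>) A - measure (negative_part \<nu>) A"
    if A: "A \<in> sets borel" for A
  proof -
    have "\<nu> A = \<nu> (A \<inter> Y) + \<nu> (A \<inter> - Y)"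
    proof -
      have "measure L A = measure L (A \<inter> Y) + measure L (A \<inter> - Y)" if "finite_borel_measure L" for L
      proof -
        interpret L: finite_borel_measure L by fact
        show ?thesis
          using A Y by (subst L.finite_measure_Union[symmetric])
            (auto simp: L.M_is_borel intro!: arg_cong[where f = "measure L"])
      qed
      from this[of M] this[of N] show ?thesis
        using A Y M.finite_borel_measure_axioms N.finite_borel_measure_axioms by (simp add: \<nu>_eq)
    qed
    moreover have "measure (positive_part \<nu>) A = \<nu> (A \<inter> Y)"
      using A Y pos[of "A \<inter> Y"] by (simp add: measure_def P)
    moreover have "measure (negative_part \<nu>) A = - \<nu> (A \<inter> - Y)"
      using A Y neg[of "A \<inter> - Y"] by (simp add: measure_def Q Int_assoc)
    ultimately show ?thesis by simp
  qed
  ultimately show ?thesis by (simp add: measure_difference_def)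
qed

text \<open>
  The Jordan parts form one representation as a difference, and all representations give
  the same integrals. So the Jordan decomposition itself never has to be computed.
\<close>
lemma signed_integral_measure_difference:
  assumes "measure_difference \<nu> M N"
    and "f \<in> borel_measurable borel" "\<And>x. \<bar>f x\<bar> \<le> B"
  shows "signed_integral \<nu> f = (LINT x|M. f x) - (LINT x|N. f x)"
  unfolding signed_integral_def
  using integral_difference_unique[OF measure_difference_Jordan[OF assms(1)] assms] .

section \<open>Convolution powers and the deconvolution kernel\<close>

lemma finite_borel_measure_convolution:
  assumes "finite_borel_measure M" "finite_borel_measure N"
  shows "finite_borel_measure (M \<star> N)"
proof -
  interpret M: finite_borel_measure M by fact
  interpret N: finite_borel_measure N by fact
  interpret finite_measure "M \<star> N"
    by (rule convolution_finite) (rule M.finite_measure_axioms N.finite_measure_axioms M.M_is_borel N.M_is_borel)+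
  show ?thesis by standard (rule sets_convolution)
qed

lemma integrable_pair_bounded:
  fixes f :: "real \<times> real \<Rightarrow> real"
  assumes "finite_borel_measure M" "finite_borel_measure N"
    and f: "f \<in> borel_measurable (borel \<Otimes>\<^sub>M borel)" "\<And>z. \<bar>f z\<bar> \<le> B"
  shows "integrable (M \<Otimes>\<^sub>M N) f"
proof -
  interpret M: finite_borel_measure M by fact
  interpret N: finite_borel_measure N by fact
  interpret finite_measure "M \<Otimes>\<^sub>M N"
    by (rule finite_measure_pair_measure) (rule M.finite_measure_axioms N.finite_measure_axioms)+
  show ?thesis
  proof (rule integrable_const_bound)
    show "f \<in> borel_measurable (M \<Otimes>\<^sub>M N)"
      by (subst measurable_cong_sets[OF sets_pair_measure_cong[OF M.M_is_borel N.M_is_borel] refl])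
        (rule f(1))
    show "AE z in M \<Otimes>\<^sub>M N. norm (f z) \<le> B"
      by (intro AE_I2) (simp add: f(2))
  qed
qed

lemma Fubini_bounded:
  fixes f :: "real \<Rightarrow> real \<Rightarrow> real"
  assumes M: "finite_borel_measure M" and N: "finite_borel_measure N"
    and f: "case_prod f \<in> borel_measurable (borel \<Otimes>\<^sub>M borel)" "\<And>x y. \<bar>f x y\<bar> \<le> B"
  shows "(LINT x|M. LINT y|N. f x y) = (LINT y|N. LINT x|M. f x y)"
proof -
  interpret M: finite_borel_measure M by fact
  interpret N: finite_borel_measure N by fact
  interpret pair_sigma_finite M N by intro_locales
  show ?thesis
    by (rule Fubini_integral[symmetric, OF integrable_pair_bounded[OF M N f(1)]]) (use f(2) in auto)
qed

lemma integral_convolution: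
  fixes f :: "real \<Rightarrow> real"
  assumes M: "finite_borel_measure M" and N: "finite_borel_measure N"
    and f: "f \<in> borel_measurable borel" "\<And>x. \<bar>f x\<bar> \<le> B"
  shows "(LINT x|(M \<star> N). f x) = (LINT x|M. LINT y|N. f (x + y))"
proof -
  interpret M: finite_borel_measure M by fact
  interpret N: finite_borel_measure N by fact
  interpret pair_sigma_finite M N by intro_locales
  note [measurable_cong] = M.M_is_borel N.M_is_borel
  note [measurable] = f(1)
  have "(\<lambda>z. f (fst z + snd z)) \<in> borel_measurable (borel \<Otimes>\<^sub>M borel)"
    by measurable
  then have int: "integrable (M \<Otimes>\<^sub>M N) (\<lambda>z. f (fst z + snd z))"
    by (rule integrable_pair_bounded[OF M N]) (rule f(2))
  have "(LINT x|(M \<star> N). f x) = (LINT z|(M \<Otimes>\<^sub>M N). f (fst z + snd z))"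
    unfolding convolution_def by (subst integral_distr) (auto simp: case_prod_beta)
  also have "\<dots> = (LINT x|M. LINT y|N. f (x + y))"
    using integral_fst'[OF int] by simp
  finally show ?thesis .
qed

lemma measurable_LINT_bounded:
  fixes f :: "real \<Rightarrow> real \<Rightarrow> real"
  assumes M: "finite_borel_measure M"
    and f: "case_prod f \<in> borel_measurable (borel \<Otimes>\<^sub>M borel)"
  shows "(\<lambda>x. LINT y|M. f x y) \<in> borel_measurable borel"
proof -
  interpret M: finite_borel_measure M by fact
  have "case_prod f \<in> borel_measurable (borel \<Otimes>\<^sub>M M)"
    by (subst measurable_cong_sets[OF sets_pair_measure_cong[OF refl M.M_is_borel] refl]) (rule f)
  then show ?thesis
    by (rule M.borel_measurable_lebesgue_integral)
qed

lemma (in finite_borel_measure) abs_LINT_le: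
  fixes f :: "real \<Rightarrow> real"
  assumes "f \<in> borel_measurable borel" "\<And>x. \<bar>f x\<bar> \<le> B"
  shows "\<bar>LINT x|M. f x\<bar> \<le> B * measure M UNIV"
proof -
  have "\<bar>LINT x|M. f x\<bar> \<le> (LINT x|M. \<bar>f x\<bar>)"
    by (rule integral_abs_bound)
  also have "\<dots> \<le> (LINT x|M. B)"
    using assms by (intro integral_mono integrable_bounded[where B = B] integrable_bounded[where B = "\<bar>B\<bar>"]) auto
  also have "\<dots> = B * measure M UNIV"
    by (simp add: borel_UNIV)
  finally show ?thesis .
qed

lemma measurable_signed_integral:
  fixes f :: "real \<Rightarrow> real \<Rightarrow> real"
  assumes d: "measure_difference \<nu> M N"
    and f: "case_prod f \<in> borel_measurable (borel \<Otimes>\<^sub>M borel)" "\<And>x y. \<bar>f x y\<bar> \<le> B"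
  shows "(\<lambda>x. signed_integral \<nu> (f x)) \<in> borel_measurable borel"
proof -
  note f(1) [measurable]
  have "f x \<in> borel_measurable borel" for x by measurable
  then have "(\<lambda>x. signed_integral \<nu> (f x)) = (\<lambda>x. (LINT y|M. f x y) - (LINT y|N. f x y))"
    using signed_integral_measure_difference[OF d _ f(2)] by auto
  moreover have "\<dots> \<in> borel_measurable borel"
    by (intro borel_measurable_diff measurable_LINT_bounded[OF measure_differenceD(1)[OF d] f(1)]
      measurable_LINT_bounded[OF measure_differenceD(2)[OF d] f(1)])
  ultimately show ?thesis by simp
qed

lemma signed_integral_Fubini:
  assumes d: "measure_difference \<nu> M N" and P: "finite_borel_measure P"
    and f: "case_prod f \<in> borel_measurable (borel \<Otimes>\<^sub>M borel)" "\<And>x y. \<bar>f x y\<bar> \<le> B"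
  shows "signed_integral \<nu> (\<lambda>x. LINT y|P. f x y) = (LINT y|P. signed_integral \<nu> (\<lambda>x. f x y))"
proof -
  interpret M: finite_borel_measure M by (rule measure_differenceD(1)[OF d])
  interpret N: finite_borel_measure N by (rule measure_differenceD(2)[OF d])
  interpret P: finite_borel_measure P by fact
  note M = M.finite_borel_measure_axioms and N = N.finite_borel_measure_axioms
  note f(1) [measurable]
  have [measurable]: "f x \<in> borel_measurable borel" "(\<lambda>x. f x y) \<in> borel_measurable borel" for x y
    by measurable
  have sw: "(\<lambda>(y, x). f x y) \<in> borel_measurable (borel \<Otimes>\<^sub>M borel)"
    by measurable
  have bd: "\<bar>LINT y|P. f x y\<bar> \<le> B * measure P UNIV" for x
    by (rule P.abs_LINT_le) (simp_all add: f(2))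
  have i: "integrable P (\<lambda>y. LINT x|L. f x y)" if L: "finite_borel_measure L" for L
  proof (rule P.integrable_bounded)
    show "norm (LINT x|L. f x y) \<le> B * measure L UNIV" for y
      unfolding real_norm_def
      by (rule finite_borel_measure.abs_LINT_le[OF L]) (simp_all add: f(2))
  qed (rule measurable_LINT_bounded[OF L sw])
  have "signed_integral \<nu> (\<lambda>x. LINT y|P. f x y) =
      (LINT x|M. LINT y|P. f x y) - (LINT x|N. LINT y|P. f x y)"
    by (rule signed_integral_measure_difference[OF d measurable_LINT_bounded[OF P f(1)] bd])
  also have "\<dots> = (LINT y|P. (LINT x|M. f x y) - (LINT x|N. f x y))"
    unfolding Fubini_bounded[OF M P f] Fubini_bounded[OF N P f]
    by (rule Bochner_Integration.integral_diff[symmetric, OF i[OF M] i[OF N]])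
  also have "\<dots> = (LINT y|P. signed_integral \<nu> (\<lambda>x. f x y))"
    by (subst signed_integral_measure_difference[OF d _ f(2)]) simp_all
  finally show ?thesis .
qed

lemma signed_integral_dominated_convergence:
  assumes d: "measure_difference \<nu> M N"
    and s: "\<And>n. s n \<in> borel_measurable borel" "\<And>n x. \<bar>s n x\<bar> \<le> B"
    and lim: "\<And>x. (\<lambda>n. s n x) \<longlonglongrightarrow> f x"
  shows "(\<lambda>n. signed_integral \<nu> (s n)) \<longlonglongrightarrow> signed_integral \<nu> f"
proof -
  have f: "f \<in> borel_measurable borel"
    by (rule borel_measurable_LIMSEQ_real[OF lim s(1)])
  have fB: "\<bar>f x\<bar> \<le> B" for x
    by (rule LIMSEQ_le_const2[OF tendsto_rabs[OF lim]]) (use s(2) in auto)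
  have *: "(\<lambda>n. LINT x|L. s n x) \<longlonglongrightarrow> (LINT x|L. f x)" if L: "finite_borel_measure L" for L
  proof -
    interpret L: finite_borel_measure L by fact
    note meas = measurable_cong_sets[OF L.M_is_borel refl, of "borel :: real measure"]
    show ?thesis
      by (rule integral_dominated_convergence[where w = "\<lambda>_. B"])
        (use s f lim in \<open>auto simp: meas\<close>)
  qed
  show ?thesis
    unfolding signed_integral_measure_difference[OF d s] signed_integral_measure_difference[OF d f fB]
    by (intro tendsto_diff * measure_differenceD[OF d])
qed

lemma signed_integral_combination:
  assumes d: "measure_difference \<nu> M N"
    and f: "f \<in> borel_measurable borel" "\<And>x. \<bar>f x\<bar> \<le> B"
    and g: "g \<in> borel_measurable borel" "\<And>x. \<bar>g x\<bar> \<le> C"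
  shows "signed_integral \<nu> (\<lambda>x. a * f x + b * g x) = a * signed_integral \<nu> f + b * signed_integral \<nu> g"
proof -
  interpret M: finite_borel_measure M by (rule measure_differenceD(1)[OF d])
  interpret N: finite_borel_measure N by (rule measure_differenceD(2)[OF d])
  have i: "integrable M f" "integrable M g" "integrable N f" "integrable N g"
    using M.integrable_bounded[OF f(1), of B] M.integrable_bounded[OF g(1), of C]
      N.integrable_bounded[OF f(1), of B] N.integrable_bounded[OF g(1), of C] f(2) g(2)
    by simp_all
  have "signed_integral \<nu> (\<lambda>x. a * f x + b * g x) =
      (LINT x|M. a * f x + b * g x) - (LINT x|N. a * f x + b * g x)"
  proof (rule signed_integral_measure_difference[OF d])
    show "(\<lambda>x. a * f x + b * g x) \<in> borel_measurable borel"
      using f(1) g(1) by measurable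
    show "\<bar>a * f x + b * g x\<bar> \<le> \<bar>a\<bar> * B + \<bar>b\<bar> * C" for x
      using mult_left_mono[OF f(2), of "\<bar>a\<bar>" x] mult_left_mono[OF g(2), of "\<bar>b\<bar>" x]
        abs_triangle_ineq[of "a * f x" "b * g x"] unfolding abs_mult by linarith
  qed
  also have "\<dots> = a * signed_integral \<nu> f + b * signed_integral \<nu> g"
    unfolding signed_integral_measure_difference[OF d f] signed_integral_measure_difference[OF d g]
    using i by (simp add: algebra_simps)
  finally show ?thesis .
qed

lemma measure_difference_add:
  assumes d: "measure_difference \<nu> M N" and e: "measure_difference \<rho> M' N'"
  shows "measure_difference (\<lambda>A. \<nu> A + \<rho> A) (plus_measure M M') (plus_measure N N')"
  unfolding measure_difference_def
proof (intro conjI ballI)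
  fix A :: "real set" assume A: "A \<in> sets borel"
  show "\<nu> A + \<rho> A = measure (plus_measure M M') A - measure (plus_measure N N') A"
    using measure_differenceD(3)[OF d A] measure_differenceD(3)[OF e A]
    unfolding measure_plus_measure[OF measure_differenceD(1)[OF d] measure_differenceD(1)[OF e] A]
      measure_plus_measure[OF measure_differenceD(2)[OF d] measure_differenceD(2)[OF e] A]
    by linarith
qed (intro finite_borel_measure_plus measure_differenceD[OF d] measure_differenceD[OF e])+

lemma signed_integral_add_measure:
  assumes d: "measure_difference \<nu> M N" and e: "measure_difference \<rho> M' N'"
    and f: "f \<in> borel_measurable borel" "\<And>x. \<bar>f x\<bar> \<le> B"
  shows "signed_integral (\<lambda>A. \<nu> A + \<rho> A) f = signed_integral \<nu> f + signed_integral \<rho> f"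
  unfolding signed_integral_measure_difference[OF measure_difference_add[OF d e] f]
    signed_integral_measure_difference[OF d f] signed_integral_measure_difference[OF e f]
    integral_plus_measure[OF measure_differenceD(1)[OF d] measure_differenceD(1)[OF e] f]
    integral_plus_measure[OF measure_differenceD(2)[OF d] measure_differenceD(2)[OF e] f]
  by linarith

lemma finite_borel_measure_return: "finite_borel_measure (return borel x)"
proof -
  interpret prob_space "return borel x" by (rule prob_space_return) simp
  show ?thesis by standard simp
qed

lemma integral_return_borel:
  fixes f :: "real \<Rightarrow> real"
  assumes "f \<in> borel_measurable borel"
  shows "(LINT x|return borel a. f x) = f a"
  using assms by (intro integral_return) auto

lemma measure_difference_dirac_minus:
  assumes "finite_borel_measure \<mu>"
  shows "measure_difference (dirac_minus \<mu>) (return borel 0) \<mu>"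
  unfolding measure_difference_def
  by (intro conjI ballI assms finite_borel_measure_return) (simp add: dirac_minus_def)

context
  fixes \<mu> :: "real measure" and \<rho> :: signed_borel and M N :: "real measure"
  assumes \<mu>: "finite_borel_measure \<mu>" and d: "measure_difference \<rho> M N"
begin

text \<open>
  This is the identity
  \<open>(\<delta> - \<mu>) * (M - N) = (M + \<mu> * N) - (N + \<mu> * M)\<close>.
\<close>
lemma measure_difference_dirac_minus_convolution:
  "measure_difference (signed_convolution (dirac_minus \<mu>) \<rho>)
     (plus_measure M (\<mu> \<star> N)) (plus_measure N (\<mu> \<star> M))"
  unfolding measure_difference_def
proof (intro conjI ballI)
  note M = measure_differenceD(1)[OF d] and N = measure_differenceD(2)[OF d]
  have \<mu>M: "finite_borel_measure (\<mu> \<star> M)" and \<mu>N: "finite_borel_measure (\<mu> \<star> N)"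
    by (rule finite_borel_measure_convolution[OF \<mu>] M N)+
  show "finite_borel_measure (plus_measure M (\<mu> \<star> N))" "finite_borel_measure (plus_measure N (\<mu> \<star> M))"
    by (rule finite_borel_measure_plus M N \<mu>M \<mu>N)+
  fix A :: "real set" assume A [measurable]: "A \<in> sets borel"
  define h where "h L x = measure L {y. x + y \<in> A}" for L x
  have hL: "h L \<in> borel_measurable borel" "\<And>x. \<bar>h L x\<bar> \<le> measure L UNIV"
      "(LINT x|\<mu>. h L x) = measure (\<mu> \<star> L) A" "h L 0 = measure L A" if L: "finite_borel_measure L" for L
  proof -
    interpret L: finite_borel_measure L by fact
    have h: "h L x = (LINT y|L. indicator A (x + y))" for x
    proof -
      have "{y. x + y \<in> A} = (\<lambda>y. x + y) -` A \<inter> space borel" by auto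
      also have "\<dots> \<in> sets borel" by (rule measurable_sets[OF _ A]) measurable
      finally have "{y. x + y \<in> A} \<in> sets L" using L.M_is_borel by simp
      then have "h L x = (LINT y|L. indicator {y. x + y \<in> A} y)"
        by (simp add: h_def L.borel_UNIV)
      also have "(\<lambda>y. indicator {y. x + y \<in> A} y) = (\<lambda>y. indicator A (x + y) :: real)"
        by (auto simp: indicator_def)
      finally show ?thesis .
    qed
    show "h L \<in> borel_measurable borel"
      unfolding h by (rule measurable_LINT_bounded[OF L]) measurable
    show "\<bar>h L x\<bar> \<le> measure L UNIV" for x
      unfolding h_def using L.bounded_measure[of "{y. x + y \<in> A}"] by (simp add: L.borel_UNIV)
    show "h L 0 = measure L A" by (simp add: h_def)
    have "(LINT x|(\<mu> \<star> L). indicator A x) = (LINT x|\<mu>. LINT y|L. indicator A (x + y) :: real)"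
      by (rule integral_convolution[OF \<mu> L, where B = 1]) (simp_all add: indicator_def)
    then show "(LINT x|\<mu>. h L x) = measure (\<mu> \<star> L) A"
      unfolding h by simp
  qed
  have \<rho>: "\<rho> {y. x + y \<in> A} = h M x - h N x" for x
  proof -
    have "{y. x + y \<in> A} = (\<lambda>y. x + y) -` A \<inter> space borel" by auto
    also have "\<dots> \<in> sets borel" by (rule measurable_sets[OF _ A]) measurable
    finally show ?thesis unfolding h_def by (rule measure_differenceD(3)[OF d])
  qed
  have hd: "(\<lambda>x. h M x - h N x) \<in> borel_measurable borel"
    by (intro borel_measurable_diff hL(1) M N)
  have hb: "\<bar>h M x - h N x\<bar> \<le> measure M UNIV + measure N UNIV" for x
    using hL(2)[OF M, of x] hL(2)[OF N, of x] by linarith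
  interpret \<mu>: finite_borel_measure \<mu> by (rule \<mu>)
  have "signed_convolution (dirac_minus \<mu>) \<rho> A = (h M 0 - h N 0) - (LINT x|\<mu>. h M x - h N x)"
    unfolding signed_convolution_def \<rho>
      signed_integral_measure_difference[OF measure_difference_dirac_minus[OF \<mu>] hd hb]
      integral_return_borel[OF hd] ..
  also have "(LINT x|\<mu>. h M x - h N x) = (LINT x|\<mu>. h M x) - (LINT x|\<mu>. h N x)"
    by (intro Bochner_Integration.integral_diff \<mu>.integrable_bounded[OF hL(1)])
      (use hL(2) M N in \<open>simp_all only: real_norm_def\<close>)
  finally show "signed_convolution (dirac_minus \<mu>) \<rho> A =
      measure (plus_measure M (\<mu> \<star> N)) A - measure (plus_measure N (\<mu> \<star> M)) A"
    by (simp add: hL M N measure_plus_measure \<mu>M \<mu>N A)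
qed

lemma signed_integral_dirac_minus_convolution:
  assumes f: "f \<in> borel_measurable borel" "\<And>x. \<bar>f x\<bar> \<le> B"
  shows "signed_integral (signed_convolution (dirac_minus \<mu>) \<rho>) f =
    signed_integral \<rho> f - (LINT x|\<mu>. signed_integral \<rho> (\<lambda>y. f (x + y)))"
proof -
  note M = measure_differenceD(1)[OF d] and N = measure_differenceD(2)[OF d]
  note f(1) [measurable]
  have \<mu>M: "finite_borel_measure (\<mu> \<star> M)" and \<mu>N: "finite_borel_measure (\<mu> \<star> N)"
    by (rule finite_borel_measure_convolution[OF \<mu>] M N)+
  interpret \<mu>: finite_borel_measure \<mu> by (rule \<mu>)
  have fm: "(\<lambda>(x, y). f (x + y)) \<in> borel_measurable (borel \<Otimes>\<^sub>M borel)" by measurable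
  have i: "integrable \<mu> (\<lambda>x. LINT y|L. f (x + y))" if L: "finite_borel_measure L" for L
  proof (rule \<mu>.integrable_bounded)
    show "norm (LINT y|L. f (x + y)) \<le> B * measure L UNIV" for x
      unfolding real_norm_def
      by (rule finite_borel_measure.abs_LINT_le[OF L]) (simp_all add: f(2))
  qed (rule measurable_LINT_bounded[OF L fm])
  have "(LINT x|\<mu>. signed_integral \<rho> (\<lambda>y. f (x + y))) =
      (LINT x|\<mu>. (LINT y|M. f (x + y)) - (LINT y|N. f (x + y)))"
    by (subst signed_integral_measure_difference[OF d _ f(2)]) simp_all
  also have "\<dots> = (LINT x|\<mu>. LINT y|M. f (x + y)) - (LINT x|\<mu>. LINT y|N. f (x + y))"
    by (rule Bochner_Integration.integral_diff[OF i[OF M] i[OF N]])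
  finally show ?thesis
    unfolding signed_integral_measure_difference[OF measure_difference_dirac_minus_convolution f]
      signed_integral_measure_difference[OF d f]
      integral_plus_measure[OF M \<mu>N f] integral_plus_measure[OF N \<mu>M f]
      integral_convolution[OF \<mu> M f] integral_convolution[OF \<mu> N f]
    by linarith
qed

end

lemma measure_difference_convolution_power_0:
  "measure_difference (convolution_power \<nu> 0) (return borel 0) (null_measure borel)"
proof -
  have "finite_borel_measure (null_measure borel :: real measure)"
    by (intro finite_borel_measure.intro finite_measureI finite_borel_measure_axioms.intro) simp_all
  then show ?thesis
    by (simp add: measure_difference_def finite_borel_measure_return measure_def)
qed

lemma convolution_power_measure_difference:
  assumes \<mu>: "finite_borel_measure \<mu>"
  shows "\<exists>M N. measure_difference (convolution_power (dirac_minus \<mu>) l) M N"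
proof (induction l)
  case 0
  show ?case using measure_difference_convolution_power_0 by blast
next
  case (Suc l)
  then obtain M N where "measure_difference (convolution_power (dirac_minus \<mu>) l) M N" by blast
  from measure_difference_dirac_minus_convolution[OF \<mu> this] show ?case
    unfolding convolution_power.simps by blast
qed

text \<open>
  Every evaluation of a convolution power below rests on this recursion.
\<close>
lemma signed_integral_convolution_power_Suc:
  assumes \<mu>: "finite_borel_measure \<mu>"
    and f: "f \<in> borel_measurable borel" "\<And>x. \<bar>f x\<bar> \<le> B"
  shows "signed_integral (convolution_power (dirac_minus \<mu>) (Suc l)) f =
    signed_integral (convolution_power (dirac_minus \<mu>) l) f
    - (LINT x|\<mu>. signed_integral (convolution_power (dirac_minus \<mu>) l) (\<lambda>y. f (x + y)))"
proof -
  obtain M N where "measure_difference (convolution_power (dirac_minus \<mu>) l) M N"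
    using convolution_power_measure_difference[OF \<mu>] by blast
  from signed_integral_dirac_minus_convolution[OF \<mu> this f] show ?thesis
    unfolding convolution_power.simps .
qed

lemma signed_integral_convolution_power_0:
  assumes f: "f \<in> borel_measurable borel" "\<And>x. \<bar>f x\<bar> \<le> B"
  shows "signed_integral (convolution_power (dirac_minus \<mu>) 0) f = f 0"
  unfolding signed_integral_measure_difference[OF measure_difference_convolution_power_0 f]
    integral_return_borel[OF f(1)] by simp

lemma decon_kernel_measure_difference:
  assumes \<mu>: "finite_borel_measure \<mu>"
  shows "\<exists>M N. measure_difference (decon_kernel_measure \<mu> m) M N"
proof (induction m)
  case 0
  then show ?case using convolution_power_measure_difference[OF \<mu>, of 0]
    by (simp add: decon_kernel_measure_def)
next
  case (Suc m)
  then obtain M N where 1: "measure_difference (decon_kernel_measure \<mu> m) M N" by blast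
  obtain M' N' where 2: "measure_difference (convolution_power (dirac_minus \<mu>) (Suc m)) M' N'"
    using convolution_power_measure_difference[OF \<mu>] by blast
  show ?case
    using measure_difference_add[OF 1 2]
    unfolding decon_kernel_measure_def sum.atMost_Suc by blast
qed

lemma signed_integral_decon_kernel_measure:
  assumes \<mu>: "finite_borel_measure \<mu>"
    and f: "f \<in> borel_measurable borel" "\<And>x. \<bar>f x\<bar> \<le> B"
  shows "signed_integral (decon_kernel_measure \<mu> m) f =
    (\<Sum>l\<le>m. signed_integral (convolution_power (dirac_minus \<mu>) l) f)"
proof (induction m)
  case 0
  show ?case by (simp add: decon_kernel_measure_def del: convolution_power.simps)
next
  case (Suc m)
  obtain M N where 1: "measure_difference (decon_kernel_measure \<mu> m) M N"
    using decon_kernel_measure_difference[OF \<mu>] by blast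
  obtain M' N' where 2: "measure_difference (convolution_power (dirac_minus \<mu>) (Suc m)) M' N'"
    using convolution_power_measure_difference[OF \<mu>] by blast
  have "decon_kernel_measure \<mu> (Suc m) =
      (\<lambda>A. decon_kernel_measure \<mu> m A + convolution_power (dirac_minus \<mu>) (Suc m) A)"
    unfolding decon_kernel_measure_def sum.atMost_Suc ..
  then show ?case
    unfolding sum.atMost_Suc Suc.IH[symmetric]
    using signed_integral_add_measure[OF 1 2 f] by (simp only:)
qed

section \<open>Sine integrals and inversion of characteristic functions\<close>

text \<open>
  The measure \<open>dt / t\<close> on \<open>(a, b]\<close>, that is, Haar measure of the multiplicative group of
  positive reals. Putting the singular factor of \<open>sin (t w) / t\<close> into a finite measure leaves
  bounded integrands, so Fubini and dominated convergence apply with constant bounds. Half-open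
  intervals make adjacent pieces disjoint.
\<close>
definition haar_interval :: "real \<Rightarrow> real \<Rightarrow> real measure" where
  "haar_interval a b = density lborel (\<lambda>t. ennreal (indicator {a<..b} t / t))"

lemma finite_borel_measure_haar_interval:
  assumes "0 < a"
  shows "finite_borel_measure (haar_interval a b)"
proof (intro finite_borel_measure.intro finite_measureI finite_borel_measure_axioms.intro)
  have "emeasure (haar_interval a b) (space (haar_interval a b)) =
      (\<integral>\<^sup>+t. ennreal (indicator {a<..b} t / t) \<partial>lborel)"
    unfolding haar_interval_def by (subst emeasure_density) simp_all
  also have "\<dots> \<le> (\<integral>\<^sup>+t. ennreal (1 / a) * indicator {a<..b} t \<partial>lborel)"
    using assms by (intro nn_integral_mono) (auto simp: indicator_def intro!: ennreal_leI frac_le)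
  also have "\<dots> < \<infinity>"
    by (cases "a \<le> b") (simp_all add: nn_integral_cmult ennreal_mult_less_top)
  finally show "emeasure (haar_interval a b) (space (haar_interval a b)) \<noteq> \<infinity>" by simp
qed (simp add: haar_interval_def)

lemma integral_haar_interval:
  fixes f :: "real \<Rightarrow> real"
  assumes "0 < a" and "f \<in> borel_measurable borel"
  shows "(LINT t|haar_interval a b. f t) = (LINT t|lborel. indicator {a<..b} t / t * f t)"
proof -
  have "(LINT t|haar_interval a b. f t) = (LINT t|lborel. (indicator {a<..b} t / t) *\<^sub>R f t)"
    unfolding haar_interval_def
    by (rule integral_density) (use assms in \<open>auto simp: indicator_def\<close>)
  then show ?thesis by simp
qed

lemma integral_haar_subinterval:
  fixes f :: "real \<Rightarrow> real"
  assumes "0 < a" "a \<le> c" "d \<le> b" and f [measurable]: "f \<in> borel_measurable borel"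
  shows "(LINT t|haar_interval a b. indicator {c<..d} t * f t) = (LINT t|haar_interval c d. f t)"
proof -
  have "(\<lambda>t. indicator {c<..d} t * f t) \<in> borel_measurable borel" by measurable
  from integral_haar_interval[OF \<open>0 < a\<close> this]
  have "(LINT t|haar_interval a b. indicator {c<..d} t * f t) =
      (LINT t|lborel. indicator {a<..b} t / t * (indicator {c<..d} t * f t))" .
  also have "\<dots> = (LINT t|lborel. indicator {c<..d} t / t * f t)"
    using assms(2,3) by (intro Bochner_Integration.integral_cong) (auto simp: indicator_def)
  also have "\<dots> = (LINT t|haar_interval c d. f t)"
    using assms by (intro integral_haar_interval[symmetric]) auto
  finally show ?thesis .
qed

lemma integral_haar_interval_sin:
  assumes "0 < a" "a \<le> b"
  shows "(LINT t|haar_interval a b. sin (t * w)) = Si (w * b) - Si (w * a)"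
proof -
  have "(LINT t|haar_interval a b. sin (t * w)) = (LINT t|lborel. indicator {a<..b} t / t * sin (t * w))"
    by (rule integral_haar_interval[OF assms(1)]) measurable
  also have "\<dots> = (LINT t|lborel. sinc (w * t) * w * indicator {a..b} t)"
  proof (rule integral_cong_AE)
    show "AE t in lborel. indicator {a<..b} t / t * sin (t * w) = sinc (w * t) * w * indicator {a..b} t"
      using AE_lborel_singleton[of a]
    proof eventually_elim
      case (elim t)
      then show ?case using assms by (auto simp: indicator_def mult.commute)
    qed
  qed measurable
  also have "\<dots> = Si (w * b) - Si (w * a)"
  proof (rule integral_FTC_Icc_real[OF assms(2)])
    fix t :: real
    show "((\<lambda>t. Si (w * t)) has_real_derivative sinc (w * t) * w) (at t)"
      by (rule DERIV_chain2[OF DERIV_Si]) (auto intro!: derivative_eq_intros)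
    show "isCont (\<lambda>t. sinc (w * t) * w) t"
      by (intro continuous_intros isCont_o2[OF _ isCont_sinc])
  qed
  finally show ?thesis .
qed

lemma Si_minus: "Si (- x) = - Si x"
  using Si_neg[of x] Si_neg[of "- x"] by (cases "0 \<le> x") auto

lemma Si_mult_at_top: "((\<lambda>T. Si (w * T)) \<longlongrightarrow> pi / 2 * sgn w) at_top"
proof -
  have pos: "((\<lambda>T. Si (u * T)) \<longlongrightarrow> pi / 2) at_top" if "0 < u" for u
    by (rule filterlim_compose[OF Si_at_top
        filterlim_tendsto_pos_mult_at_top[OF tendsto_const that filterlim_ident]])
  have Si0: "Si 0 = 0" using Si_minus[of 0] by simp
  show ?thesis
  proof (cases w "0::real" rule: linorder_cases)
    case less
    then have "((\<lambda>T. - Si ((- w) * T)) \<longlongrightarrow> - (pi / 2)) at_top"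
      by (intro tendsto_minus pos) simp
    with less show ?thesis by (simp add: Si_minus)
  next
    case equal
    then show ?thesis by (simp add: Si0)
  next
    case greater
    with pos show ?thesis by simp
  qed
qed

text \<open>
  On a fine partition of \<open>[a, b]\<close>, the continuous function \<open>P\<close> is nearly constant on each cell,
  and the integral is close to a sum of the values of \<open>P\<close> times increments of the primitive of
  \<open>g\<close>. Abel summation moves the increments to \<open>P\<close>. The result is a form of the second mean
  value theorem for functions of bounded variation: it profits from the oscillation of \<open>g\<close>, since
  only its primitive enters the bound.
\<close>
lemma Abel_summation_bounded_variation:
  fixes g P :: "real \<Rightarrow> real"
  assumes H: "finite_borel_measure H"
    and g: "g \<in> borel_measurable borel" "\<And>x. \<bar>g x\<bar> \<le> 1"
    and P: "continuous_on UNIV P" "\<And>x. \<bar>P x\<bar> \<le> C"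
    and "a \<le> b"
    and var: "\<And>n t. incseq t \<Longrightarrow> t 0 = a \<Longrightarrow> (\<Sum>i<n. \<bar>P (t (Suc i)) - P (t i)\<bar>) \<le> V"
    and small: "\<And>c. c \<in> {a..b} \<Longrightarrow> \<bar>LINT x|H. indicator {a<..c} x * g x\<bar> \<le> e"
  shows "\<bar>LINT x|H. indicator {a<..b} x * (g x * P x)\<bar> \<le> e * (\<bar>P b\<bar> + V)"
proof (rule field_le_epsilon)
  interpret H: finite_borel_measure H by (rule H)
  fix \<epsilon> :: real assume "0 < \<epsilon>"
  define \<delta> where "\<delta> = \<epsilon> / (1 + measure H UNIV)"
  have nn: "0 \<le> measure H UNIV" by simp
  then have pos: "0 < 1 + measure H UNIV" by linarith
  then have \<delta>: "0 < \<delta>" using \<open>0 < \<epsilon>\<close> by (simp add: \<delta>_def)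
  have "\<delta> * (1 + measure H UNIV) = \<epsilon>" using pos by (simp add: \<delta>_def)
  then have \<delta>': "\<delta> * measure H UNIV \<le> \<epsilon>" using \<delta> by (simp add: distrib_left)
  have Pm [measurable]: "P \<in> borel_measurable borel"
    by (rule borel_measurable_continuous_onI[OF P(1)])
  note g(1) [measurable]
  have "uniformly_continuous_on {a..b} P"
    by (rule compact_uniformly_continuous[OF continuous_on_subset[OF P(1)]]) auto
  then obtain d where d: "0 < d"
    "\<And>x y. x \<in> {a..b} \<Longrightarrow> y \<in> {a..b} \<Longrightarrow> dist y x < d \<Longrightarrow> dist (P y) (P x) < \<delta>"
    using \<delta> unfolding uniformly_continuous_on_def by metis
  obtain n :: nat where n: "(b - a) / d < n" using reals_Archimedean2 by blast
  have n0: "0 < n" using n d(1) \<open>a \<le> b\<close> by (cases n) (auto simp: divide_less_0_iff)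
  \<comment> \<open>An equidistant partition of mesh below the modulus of continuity of \<open>P\<close> for \<open>\<delta>\<close>.\<close>
  define h where "h = (b - a) / n"
  have h: "0 \<le> h" "h < d" "a + h * n = b"
    using n n0 d(1) \<open>a \<le> b\<close> by (auto simp: h_def field_simps)
  define t where "t i = a + h * real i" for i
  have t: "t 0 = a" "t n = b" "incseq t" "t (Suc i) = t i + h" for i
    using h by (auto simp: t_def incseq_def algebra_simps mult_left_mono)
  have t_in: "t i \<in> {a..b}" if "i \<le> n" for i
    using t(1,2) incseqD[OF t(3), of 0 i] incseqD[OF t(3) that] by simp
  define J where "J i x = (indicator {t i<..t (Suc i)} x :: real)" for i x
  have J_sum: "(\<Sum>i<k. J i x) = indicator {a<..t k} x" for k x
  proof (induction k)
    case 0
    then show ?case by (simp add: t)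
  next
    case (Suc k)
    have "a \<le> t k" "t k \<le> t (Suc k)"
      using incseqD[OF t(3), of 0 k] incseqD[OF t(3), of k "Suc k"] t(1) by simp_all
    with Suc show ?case by (auto simp: J_def indicator_def)
  qed
  have J_sum_n: "(\<Sum>i<n. J i x) = indicator {a<..b} x" for x
    using J_sum[of x n] by (simp add: t(2))
  have [measurable]: "J i \<in> borel_measurable borel" for i
    unfolding J_def by measurable
  define G where "G i = (LINT x|H. indicator {a<..t i} x * g x)" for i
  have int: "integrable H (\<lambda>x. J i x * g x)" "integrable H (\<lambda>x. indicator {a<..c} x * g x)" for i c
    using g(2) by (auto intro!: H.integrable_bounded[where B = 1] simp: J_def indicator_def)
  have G_diff: "(LINT x|H. J i x * g x) = G (Suc i) - G i" for i
  proof -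
    have "G (Suc i) = (LINT x|H. indicator {a<..t i} x * g x + J i x * g x)"
      unfolding G_def J_sum[symmetric] by (simp add: distrib_right)
    also have "\<dots> = G i + (LINT x|H. J i x * g x)"
      unfolding G_def by (rule Bochner_Integration.integral_add[OF int(2) int(1)])
    finally show ?thesis by simp
  qed
  have Abel: "(\<Sum>i<k. P (t (Suc i)) * (G (Suc i) - G i)) =
      P (t k) * G k - (\<Sum>i<k. G i * (P (t (Suc i)) - P (t i)))" for k
  proof (induction k)
    case 0
    have "G 0 = 0" by (simp add: G_def t(1))
    then show ?case by simp
  next
    case (Suc k)
    then show ?case by (simp add: algebra_simps)
  qed
  \<comment> \<open>The error of replacing \<open>P\<close> on each cell by its value at the right end point.\<close>
  define r where "r x = (\<Sum>i<n. J i x * (g x * (P x - P (t (Suc i)))))" for x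
  have r_meas: "r \<in> borel_measurable borel" unfolding r_def by measurable
  have r_le: "\<bar>r x\<bar> \<le> \<delta>" for x
  proof -
    have "\<bar>r x\<bar> \<le> (\<Sum>i<n. \<bar>J i x * (g x * (P x - P (t (Suc i))))\<bar>)"
      unfolding r_def by (rule sum_abs)
    also have "\<dots> \<le> (\<Sum>i<n. J i x * \<delta>)"
    proof (rule sum_mono)
      fix i assume i: "i \<in> {..<n}"
      show "\<bar>J i x * (g x * (P x - P (t (Suc i))))\<bar> \<le> J i x * \<delta>"
      proof (cases "x \<in> {t i<..t (Suc i)}")
        case True
        have tt: "t i \<in> {a..b}" "t (Suc i) \<in> {a..b}" using i t_in[of i] t_in[of "Suc i"] by simp_all
        then have "x \<in> {a..b}" "dist x (t (Suc i)) < d"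
          using True h t(4)[of i] by (auto simp: dist_real_def)
        with d(2)[OF tt(2)] have "\<bar>P x - P (t (Suc i))\<bar> \<le> \<delta>"
          by (simp add: dist_real_def less_imp_le)
        then have "\<bar>g x\<bar> * \<bar>P x - P (t (Suc i))\<bar> \<le> 1 * \<delta>"
          by (intro mult_mono g(2)) auto
        with True show ?thesis by (simp add: J_def abs_mult)
      qed (simp add: J_def)
    qed
    also have "\<dots> = indicator {a<..b} x * \<delta>"
      unfolding sum_distrib_right[symmetric] J_sum_n ..
    also have "\<dots> \<le> \<delta>" using \<delta> by (simp add: indicator_def)
    finally show ?thesis .
  qed
  have split: "indicator {a<..b} x * (g x * P x) = r x + (\<Sum>i<n. P (t (Suc i)) * (J i x * g x))" for x
  proof -
    have "indicator {a<..b} x * (g x * P x) = (\<Sum>i<n. J i x * (g x * P x))"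
      unfolding J_sum_n[symmetric] sum_distrib_right ..
    then show ?thesis
      unfolding r_def sum.distrib[symmetric] by (simp add: algebra_simps)
  qed
  have "(LINT x|H. indicator {a<..b} x * (g x * P x)) =
      (LINT x|H. r x) + (\<Sum>i<n. P (t (Suc i)) * (G (Suc i) - G i))"
    unfolding split
    by (subst Bochner_Integration.integral_add)
      (auto intro!: H.integrable_bounded[OF r_meas, where B = \<delta>] simp: r_le int G_diff)
  also have "\<bar>\<dots>\<bar> \<le> \<delta> * measure H UNIV + (\<bar>P b * G n\<bar> + (\<Sum>i<n. \<bar>G i * (P (t (Suc i)) - P (t i))\<bar>))"
  proof -
    have "\<bar>LINT x|H. r x\<bar> \<le> \<delta> * measure H UNIV"
      by (rule H.abs_LINT_le[OF r_meas r_le])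
    moreover have "\<bar>\<Sum>i<n. G i * (P (t (Suc i)) - P (t i))\<bar> \<le> (\<Sum>i<n. \<bar>G i * (P (t (Suc i)) - P (t i))\<bar>)"
      by (rule sum_abs)
    ultimately show ?thesis unfolding Abel t(2) by linarith
  qed
  also have "\<dots> \<le> \<epsilon> + (\<bar>P b\<bar> * e + e * V)"
  proof (intro add_mono \<delta>')
    have Ge: "\<bar>G i\<bar> \<le> e" if "i \<le> n" for i
      unfolding G_def by (rule small[OF t_in[OF that]])
    then show "\<bar>P b * G n\<bar> \<le> \<bar>P b\<bar> * e"
      unfolding abs_mult by (intro mult_left_mono) auto
    have "0 \<le> e" using Ge[of 0] by simp
    have "(\<Sum>i<n. \<bar>G i * (P (t (Suc i)) - P (t i))\<bar>) \<le> (\<Sum>i<n. e * \<bar>P (t (Suc i)) - P (t i)\<bar>)"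
      unfolding abs_mult by (intro sum_mono mult_right_mono Ge) auto
    also have "\<dots> \<le> e * V"
      unfolding sum_distrib_left[symmetric] by (rule mult_left_mono[OF var[OF t(3,1)] \<open>0 \<le> e\<close>])
    finally show "(\<Sum>i<n. \<bar>G i * (P (t (Suc i)) - P (t i))\<bar>) \<le> e * V" .
  qed
  finally show "\<bar>LINT x|H. indicator {a<..b} x * (g x * P x)\<bar> \<le> e * (\<bar>P b\<bar> + V) + \<epsilon>"
    by (simp add: algebra_simps)
qed

lemma char_sin_integral:
  assumes "real_distribution M"
  shows "(LINT x|M. sin (t * (w - x))) = sin (t * w) * Re (char M t) - cos (t * w) * Im (char M t)"
proof -
  interpret real_distribution M by fact
  have c: "integrable M (\<lambda>x. cos (t * x))" and s: "integrable M (\<lambda>x. sin (t * x))"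
    by (auto intro!: integrable_bounded[where B = 1] borel_measurable_continuous_onI continuous_intros)
  have Re: "(LINT x|M. cos (t * x)) = Re (char M t)"
    and Im: "(LINT x|M. sin (t * x)) = Im (char M t)"
    using integrable_iexp[of "\<lambda>x. complex_of_real (t * x)"]
    by (simp_all add: char_def integral_Re[symmetric] integral_Im[symmetric] Re_exp Im_exp)
  have eq: "sin (t * (w - x)) = sin (t * w) * cos (t * x) - cos (t * w) * sin (t * x)" for x
    by (simp add: right_diff_distrib sin_diff)
  show ?thesis
    unfolding eq using c s by (simp add: Re Im)
qed

text \<open>
  The left-hand side is the imaginary part of \<open>exp (i t w)\<close> times the conjugate Fourier
  transform of the convolution power of \<open>\<delta> - \<mu>\<close>; the transform is the real number
  \<open>(1 - char \<mu> t) ^ l\<close>.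
\<close>
lemma signed_integral_convolution_power_sin:
  assumes \<mu>: "real_distribution \<mu>" and real: "char \<mu> t \<in> \<real>"
  shows "signed_integral (convolution_power (dirac_minus \<mu>) l) (\<lambda>x. sin (t * (w - x))) =
    sin (t * w) * (1 - Re (char \<mu> t)) ^ l"
proof (induction l arbitrary: w)
  case 0
  have "signed_integral (convolution_power (dirac_minus \<mu>) 0) (\<lambda>x. sin (t * (w - x))) = sin (t * (w - 0))"
    by (rule signed_integral_convolution_power_0[where B = 1]) (auto intro!: borel_measurable_continuous_onI continuous_intros)
  then show ?case by simp
next
  case (Suc l)
  interpret real_distribution \<mu> by fact
  have Im: "Im (char \<mu> t) = 0" using real by (simp add: complex_is_Real_iff)
  have shift: "sin (t * (w - (x + y))) = sin (t * ((w - x) - y))" for x y by (simp add: algebra_simps)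
  have "signed_integral (convolution_power (dirac_minus \<mu>) (Suc l)) (\<lambda>x. sin (t * (w - x))) =
      signed_integral (convolution_power (dirac_minus \<mu>) l) (\<lambda>x. sin (t * (w - x))) -
      (LINT x|\<mu>. signed_integral (convolution_power (dirac_minus \<mu>) l) (\<lambda>y. sin (t * (w - (x + y)))))"
    by (rule signed_integral_convolution_power_Suc[OF finite_borel_measure_M, where B = 1])
      (auto intro!: borel_measurable_continuous_onI continuous_intros)
  also have "\<dots> = sin (t * w) * (1 - Re (char \<mu> t)) ^ l -
      (LINT x|\<mu>. sin (t * (w - x)) * (1 - Re (char \<mu> t)) ^ l)"
    unfolding shift Suc.IH ..
  also have "(LINT x|\<mu>. sin (t * (w - x)) * (1 - Re (char \<mu> t)) ^ l) =
      sin (t * w) * Re (char \<mu> t) * (1 - Re (char \<mu> t)) ^ l"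
    by (simp add: char_sin_integral[OF \<mu>] Im)
  finally show ?case by (simp add: algebra_simps)
qed

text \<open>
  The measure \<open>\<delta> - \<mu>\<close> has total mass zero, hence so have its convolution powers with
  positive exponent.
\<close>
lemma signed_integral_convolution_power_const:
  assumes \<mu>: "real_distribution \<mu>"
  shows "signed_integral (convolution_power (dirac_minus \<mu>) (Suc l)) (\<lambda>x. c) = 0"
proof -
  interpret real_distribution \<mu> by fact
  have "signed_integral (convolution_power (dirac_minus \<mu>) (Suc l)) (\<lambda>x. c) =
      signed_integral (convolution_power (dirac_minus \<mu>) l) (\<lambda>x. c) -
      (LINT x|\<mu>. signed_integral (convolution_power (dirac_minus \<mu>) l) (\<lambda>y. c))"
    by (rule signed_integral_convolution_power_Suc[OF finite_borel_measure_M, where B = "\<bar>c\<bar>"]) simp_all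
  then show ?thesis by (simp add: prob_space del: convolution_power.simps space_eq_univ)
qed

text \<open>
  A Gil-Pelaez type inversion: \<open>sgn\<close> is the bounded pointwise limit of
  \<open>2 / pi * (Si (w T) - Si (w \<epsilon>))\<close>, which is an integral of sines against \<open>dt / t\<close>. Cutting off
  near \<open>t = 0\<close> as well as at infinity makes Fubini applicable: on \<open>(0, T]\<close> the integral of
  \<open>\<bar>sin (t x) / t\<bar>\<close> grows logarithmically in \<open>x\<close>, and \<open>\<mu>\<close> may lack a logarithmic moment.
\<close>
lemma signed_integral_sgn_inversion:
  assumes \<mu>: "real_distribution \<mu>" and real: "\<And>t. char \<mu> t \<in> \<real>"
  shows "(\<lambda>n. LINT t|haar_interval (1 / real (Suc n)) (real (Suc n)).
            sin (t * w) * (1 - Re (char \<mu> t)) ^ l)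
    \<longlonglongrightarrow> pi / 2 * signed_integral (convolution_power (dirac_minus \<mu>) l) (\<lambda>x. sgn (w - x))"
proof -
  interpret real_distribution \<mu> by fact
  let ?\<pi> = "convolution_power (dirac_minus \<mu>) l"
  obtain M N where d: "measure_difference ?\<pi> M N"
    using convolution_power_measure_difference[OF finite_borel_measure_M] by blast
  obtain B where B: "\<And>x. \<bar>Si x\<bar> \<le> B" using bounded_Si by blast
  have "(LINT t|haar_interval (1 / real (Suc n)) (real (Suc n)). sin (t * w) * (1 - Re (char \<mu> t)) ^ l) =
      signed_integral ?\<pi> (\<lambda>x. Si ((w - x) * real (Suc n)) - Si ((w - x) * (1 / real (Suc n))))" for n
  proof -
    have H: "finite_borel_measure (haar_interval (1 / real (Suc n)) (real (Suc n)))"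
      by (rule finite_borel_measure_haar_interval) simp
    have le: "1 / real (Suc n) \<le> real (Suc n)"
      by (rule order_trans[of _ 1]) (simp_all add: divide_le_eq)
    have sin_meas: "(\<lambda>(x, t). sin (t * (w - x))) \<in> borel_measurable (borel \<Otimes>\<^sub>M borel)"
      by measurable
    have "(LINT t|haar_interval (1 / real (Suc n)) (real (Suc n)). sin (t * w) * (1 - Re (char \<mu> t)) ^ l) =
      (LINT t|haar_interval (1 / real (Suc n)) (real (Suc n)). signed_integral ?\<pi> (\<lambda>x. sin (t * (w - x))))"
      unfolding signed_integral_convolution_power_sin[OF \<mu> real] ..
    also have "\<dots> = signed_integral ?\<pi> (\<lambda>x. LINT t|haar_interval (1 / real (Suc n)) (real (Suc n)). sin (t * (w - x)))"
      by (rule signed_integral_Fubini[OF d H, where B = 1, symmetric])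
        (rule sin_meas, simp)
    also have "(\<lambda>x. LINT t|haar_interval (1 / real (Suc n)) (real (Suc n)). sin (t * (w - x))) =
        (\<lambda>x. Si ((w - x) * real (Suc n)) - Si ((w - x) * (1 / real (Suc n))))"
      by (rule ext) (rule integral_haar_interval_sin[OF _ le], simp)
    finally show ?thesis .
  qed
  moreover have "(\<lambda>n. signed_integral ?\<pi> (\<lambda>x. Si ((w - x) * real (Suc n)) - Si ((w - x) * (1 / real (Suc n)))))
      \<longlonglongrightarrow> signed_integral ?\<pi> (\<lambda>x. pi / 2 * sgn (w - x))"
  proof (rule signed_integral_dominated_convergence[OF d])
    show "(\<lambda>x. Si ((w - x) * real (Suc n)) - Si ((w - x) * (1 / real (Suc n)))) \<in> borel_measurable borel" for n
      by measurable
    show "\<bar>Si ((w - x) * real (Suc n)) - Si ((w - x) * (1 / real (Suc n)))\<bar> \<le> 2 * B" for n x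
      using B[of "(w - x) * real (Suc n)"] B[of "(w - x) * (1 / real (Suc n))"] by linarith
    fix x
    have "(\<lambda>n. Si ((w - x) * real (Suc n))) \<longlonglongrightarrow> pi / 2 * sgn (w - x)"
      by (rule filterlim_compose[OF Si_mult_at_top filterlim_compose[OF filterlim_real_sequentially filterlim_Suc]])
    moreover have "(\<lambda>n. Si ((w - x) * (1 / real (Suc n)))) \<longlonglongrightarrow> Si ((w - x) * 0)"
      by (intro isCont_tendsto_compose[OF isCont_Si] tendsto_mult tendsto_const LIMSEQ_Suc lim_1_over_n)
    ultimately have "(\<lambda>n. Si ((w - x) * real (Suc n)) - Si ((w - x) * (1 / real (Suc n))))
        \<longlonglongrightarrow> pi / 2 * sgn (w - x) - Si ((w - x) * 0)"
      by (rule tendsto_diff)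
    then show "(\<lambda>n. Si ((w - x) * real (Suc n)) - Si ((w - x) * (1 / real (Suc n))))
        \<longlonglongrightarrow> pi / 2 * sgn (w - x)"
      using Si_minus[of 0] by simp
  qed
  moreover have "signed_integral ?\<pi> (\<lambda>x. pi / 2 * sgn (w - x)) = pi / 2 * signed_integral ?\<pi> (\<lambda>x. sgn (w - x))"
  proof -
    have m: "(\<lambda>x. sgn (w - x)) \<in> borel_measurable borel" by measurable
    have b: "\<bar>sgn (w - x)\<bar> \<le> 1" for x by (simp add: abs_sgn_eq)
    show ?thesis
      using signed_integral_combination[OF d m b m b, of "pi / 2" 0] by simp
  qed
  ultimately show ?thesis by (simp only:)
qed

section \<open>Midpoints of the deconvolution function\<close>

lemma cdf_convolution:
  assumes "real_distribution chi" "real_distribution \<mu>"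
  shows "cdf (chi \<star> \<mu>) u = (LINT y|\<mu>. cdf chi (u - y))"
proof -
  interpret X: real_distribution chi by fact
  interpret M: real_distribution \<mu> by fact
  interpret C: finite_borel_measure "chi \<star> \<mu>"
    by (rule finite_borel_measure_convolution[OF X.finite_borel_measure_M M.finite_borel_measure_M])
  have m: "(\<lambda>(x, y). indicator {..u} (x + y) :: real) \<in> borel_measurable (borel \<Otimes>\<^sub>M borel)"
    by measurable
  have "cdf (chi \<star> \<mu>) u = (LINT x|(chi \<star> \<mu>). indicator {..u} x)"
    by (simp add: cdf_def)
  also have "\<dots> = (LINT x|chi. LINT y|\<mu>. indicator {..u} (x + y))"
    by (rule integral_convolution[OF X.finite_borel_measure_M M.finite_borel_measure_M, where B = 1])
      (simp_all add: indicator_def)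
  also have "\<dots> = (LINT y|\<mu>. LINT x|chi. indicator {..u} (x + y))"
    by (rule Fubini_bounded[OF X.finite_borel_measure_M M.finite_borel_measure_M m, where B = 1])
      (simp add: indicator_def)
  also have "\<dots> = (LINT y|\<mu>. cdf chi (u - y))"
  proof (rule Bochner_Integration.integral_cong[OF refl])
    fix y
    have "(LINT x|chi. indicator {..u} (x + y)) = (LINT x|chi. indicator {..u - y} x :: real)"
      by (rule Bochner_Integration.integral_cong) (auto simp: indicator_def)
    then show "(LINT x|chi. indicator {..u} (x + y)) = cdf chi (u - y)"
      by (simp add: cdf_def)
  qed
  finally show ?thesis .
qed

lemma measurable_cdf: "real_distribution chi \<Longrightarrow> cdf chi \<in> borel_measurable borel"
  by (intro borel_measurable_mono monoI finite_borel_measure.cdf_nondecreasing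
      real_distribution.finite_borel_measure_M)

lemma abs_cdf_le_1: "real_distribution chi \<Longrightarrow> \<bar>cdf chi x\<bar> \<le> 1"
  using finite_borel_measure.cdf_nonneg[OF real_distribution.finite_borel_measure_M]
    real_distribution.cdf_bounded_prob by fastforce

text \<open>
  Convolution with \<open>\<mu> = \<delta> - (\<delta> - \<mu>)\<close> turns each summand of the kernel into a difference of
  consecutive convolution powers of \<open>\<delta> - \<mu>\<close>.
\<close>
lemma deconvolution_telescope:
  assumes chi: "real_distribution chi" and \<mu>: "real_distribution \<mu>"
  shows "deconvolution chi \<mu> \<xi> m =
    cdf chi \<xi> - signed_integral (convolution_power (dirac_minus \<mu>) (Suc m)) (\<lambda>x. cdf chi (\<xi> - x))"
proof -
  interpret X: real_distribution chi by fact
  interpret M: real_distribution \<mu> by fact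
  note [measurable] = measurable_cdf[OF chi]
  let ?SI = "\<lambda>l. signed_integral (convolution_power (dirac_minus \<mu>) l)"
  let ?f = "\<lambda>x. cdf chi (\<xi> - x)"
  have fm: "?f \<in> borel_measurable borel" by measurable
  have step: "?SI l (\<lambda>x. cdf (chi \<star> \<mu>) (\<xi> - x)) = ?SI l ?f - ?SI (Suc l) ?f" for l
  proof -
    obtain A B where d: "measure_difference (convolution_power (dirac_minus \<mu>) l) A B"
      using convolution_power_measure_difference[OF M.finite_borel_measure_M] by blast
    have m: "(\<lambda>(x, y). cdf chi (\<xi> - x - y)) \<in> borel_measurable (borel \<Otimes>\<^sub>M borel)" by measurable
    have "?SI l (\<lambda>x. cdf (chi \<star> \<mu>) (\<xi> - x)) = ?SI l (\<lambda>x. LINT y|\<mu>. cdf chi (\<xi> - x - y))"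
      unfolding cdf_convolution[OF chi \<mu>] ..
    also have "\<dots> = (LINT y|\<mu>. ?SI l (\<lambda>x. cdf chi (\<xi> - x - y)))"
      by (rule signed_integral_Fubini[OF d M.finite_borel_measure_M m abs_cdf_le_1[OF chi]])
    also have "\<dots> = (LINT y|\<mu>. ?SI l (\<lambda>x. ?f (y + x)))"
      by (simp add: algebra_simps)
    also have "\<dots> = ?SI l ?f - ?SI (Suc l) ?f"
      unfolding signed_integral_convolution_power_Suc[OF M.finite_borel_measure_M fm abs_cdf_le_1[OF chi]]
      by simp
    finally show ?thesis .
  qed
  have cm: "(\<lambda>x. cdf (chi \<star> \<mu>) (\<xi> - x)) \<in> borel_measurable borel"
    unfolding cdf_convolution[OF chi \<mu>] by (rule measurable_LINT_bounded[OF M.finite_borel_measure_M]) measurable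
  have cb: "\<bar>cdf (chi \<star> \<mu>) (\<xi> - x)\<bar> \<le> 1 * measure \<mu> UNIV" for x
    unfolding cdf_convolution[OF chi \<mu>]
    by (rule M.abs_LINT_le) (measurable, rule abs_cdf_le_1[OF chi])
  have "deconvolution chi \<mu> \<xi> m = (\<Sum>l\<le>m. ?SI l ?f - ?SI (Suc l) ?f)"
    unfolding deconvolution_def signed_integral_decon_kernel_measure[OF M.finite_borel_measure_M cm cb] step ..
  also have "\<dots> = ?SI 0 ?f - ?SI (Suc m) ?f"
    by (rule sum_telescope)
  also have "?SI 0 ?f = cdf chi \<xi>"
    using signed_integral_convolution_power_0[OF fm abs_cdf_le_1[OF chi]] by simp
  finally show ?thesis .
qed

lemma left_limit_eqI: "(Q \<longlongrightarrow> L) (at_left \<xi>) \<Longrightarrow> left_limit Q \<xi> = L"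
  unfolding left_limit_def by (rule tendsto_Lim) simp_all

lemma left_limit_cdf: "real_distribution chi \<Longrightarrow> left_limit (cdf chi) \<xi> = measure chi {..<\<xi>}"
  by (intro left_limit_eqI finite_borel_measure.cdf_at_left real_distribution.finite_borel_measure_M)

text \<open>
  At a jump the value \<open>sgn 0 = 0\<close> counts half of the atom. This is why midpoints of distribution
  functions, rather than the functions themselves, are what sine integrals recover.
\<close>
lemma cdf_midpoint_sgn:
  assumes "real_distribution chi"
  shows "(cdf chi u + measure chi {..<u}) / 2 = (LINT z|chi. (1 + sgn (u - z)) / 2)"
proof -
  interpret real_distribution chi by fact
  have "(LINT z|chi. (1 + sgn (u - z)) / 2) = (LINT z|chi. (indicator {..u} z + indicator {..<u} z) / 2)"
    by (rule Bochner_Integration.integral_cong) (auto simp: indicator_def sgn_if)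
  also have "\<dots> = (cdf chi u + measure chi {..<u}) / 2"
    by (subst integral_divide_zero, subst Bochner_Integration.integral_add)
      (auto simp: cdf_def intro!: integrable_bounded[where B = 1])
  finally show ?thesis by simp
qed

text \<open>
  The constant part of \<open>(1 + sgn) / 2\<close> disappears because convolution powers of
  \<open>\<delta> - \<mu>\<close> with positive exponent have mass zero; only the sign integral, which the
  inversion formula evaluates, is left.
\<close>
lemma deconvolution_midpoint:
  assumes chi: "real_distribution chi" and \<mu>: "real_distribution \<mu>"
  shows "(deconvolution chi \<mu> \<xi> m + left_limit (\<lambda>x. deconvolution chi \<mu> x m) \<xi>) / 2 =
    (cdf chi \<xi> + left_limit (cdf chi) \<xi>) / 2 -
    (LINT z|chi. signed_integral (convolution_power (dirac_minus \<mu>) (Suc m)) (\<lambda>x. sgn (\<xi> - z - x))) / 2"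
proof -
  interpret X: real_distribution chi by fact
  interpret M: real_distribution \<mu> by fact
  note [measurable] = measurable_cdf[OF chi]
  let ?\<pi> = "convolution_power (dirac_minus \<mu>) (Suc m)"
  let ?SI = "signed_integral ?\<pi>"
  obtain A B where d: "measure_difference ?\<pi> A B"
    using convolution_power_measure_difference[OF M.finite_borel_measure_M] by blast
  have left: "(\<lambda>n. ?SI (\<lambda>x. cdf chi (S n - x))) \<longlonglongrightarrow> ?SI (\<lambda>x. measure chi {..<\<xi> - x})"
    if S: "\<And>n. S n < \<xi>" "S \<longlonglongrightarrow> \<xi>" for S
  proof (rule signed_integral_dominated_convergence[OF d])
    show "(\<lambda>x. cdf chi (S n - x)) \<in> borel_measurable borel" for n by measurable
    show "\<bar>cdf chi (S n - x)\<bar> \<le> 1" for n x by (rule abs_cdf_le_1[OF chi])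
    fix x
    have "filterlim (\<lambda>n. S n - x) (at_left (\<xi> - x)) sequentially"
      unfolding filterlim_at using S(1)
      by (auto intro!: tendsto_intros S(2) always_eventually)
    then show "(\<lambda>n. cdf chi (S n - x)) \<longlonglongrightarrow> measure chi {..<\<xi> - x}"
      by (rule filterlim_compose[OF X.cdf_at_left])
  qed
  \<comment> \<open>Left limits of the distribution function are measurable as limits of translates.\<close>
  have lm: "(\<lambda>x. measure chi {..<\<xi> - x}) \<in> borel_measurable borel"
  proof (rule borel_measurable_LIMSEQ_real)
    fix x
    have "filterlim (\<lambda>n. \<xi> - x - 1 / real (Suc n)) (at_left (\<xi> - x)) sequentially"
      unfolding filterlim_at
      using tendsto_diff[OF tendsto_const LIMSEQ_Suc[OF lim_1_over_n], of "\<xi> - x"]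
      by (auto intro!: always_eventually)
    then show "(\<lambda>n. cdf chi (\<xi> - x - 1 / real (Suc n))) \<longlonglongrightarrow> measure chi {..<\<xi> - x}"
      by (rule filterlim_compose[OF X.cdf_at_left])
    show "(\<lambda>x. cdf chi (\<xi> - x - 1 / real (Suc n))) \<in> borel_measurable borel" for n by measurable
  qed
  have lb: "\<bar>measure chi {..<\<xi> - x}\<bar> \<le> 1" for x by simp
  have fm: "(\<lambda>x. cdf chi (\<xi> - x)) \<in> borel_measurable borel" by measurable
  have "((\<lambda>x. deconvolution chi \<mu> x m) \<longlongrightarrow> measure chi {..<\<xi>} - ?SI (\<lambda>x. measure chi {..<\<xi> - x})) (at_left \<xi>)"
    unfolding deconvolution_telescope[OF chi \<mu>]
  proof (intro tendsto_diff X.cdf_at_left)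
    show "((\<lambda>x. ?SI (\<lambda>xa. cdf chi (x - xa))) \<longlongrightarrow> ?SI (\<lambda>x. measure chi {..<\<xi> - x})) (at_left \<xi>)"
      by (rule tendsto_at_left_sequentially[of "\<xi> - 1"]) (simp, rule left)
  qed
  then have ll: "left_limit (\<lambda>x. deconvolution chi \<mu> x m) \<xi> =
      measure chi {..<\<xi>} - ?SI (\<lambda>x. measure chi {..<\<xi> - x})"
    by (rule left_limit_eqI)
  have one: "(\<lambda>x. 1) \<in> borel_measurable (borel :: real measure)" "\<bar>1::real\<bar> \<le> 1" by simp_all
  have sg: "(\<lambda>x. sgn (w - x)) \<in> borel_measurable borel" for w :: real
    by measurable
  have sb: "\<bar>sgn (w - x)\<bar> \<le> 1" for w x :: real by (simp add: abs_sgn_eq)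
  have SI_h: "?SI (\<lambda>x. (1 + sgn (\<xi> - x - z)) / 2) = ?SI (\<lambda>x. sgn (\<xi> - z - x)) / 2" for z
  proof -
    have "(\<lambda>x. (1 + sgn (\<xi> - x - z)) / 2) = (\<lambda>x. 1 / 2 * 1 + 1 / 2 * sgn (\<xi> - z - x))"
      by (auto simp: algebra_simps)
    then show ?thesis
      using signed_integral_combination[OF d one sg sb, of "1/2" "1/2" "\<xi> - z"]
        signed_integral_convolution_power_const[OF M.real_distribution_axioms, of m 1]
      by (simp del: convolution_power.simps)
  qed
  have "(?SI (\<lambda>x. cdf chi (\<xi> - x)) + ?SI (\<lambda>x. measure chi {..<\<xi> - x})) / 2 =
      ?SI (\<lambda>x. 1 / 2 * cdf chi (\<xi> - x) + 1 / 2 * measure chi {..<\<xi> - x})"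
    unfolding signed_integral_combination[OF d fm abs_cdf_le_1[OF chi] lm lb] by simp
  also have "\<dots> = ?SI (\<lambda>x. LINT z|chi. (1 + sgn (\<xi> - x - z)) / 2)"
    unfolding cdf_midpoint_sgn[OF chi, symmetric] by (simp add: add_divide_distrib)
  also have "\<dots> = (LINT z|chi. ?SI (\<lambda>x. (1 + sgn (\<xi> - x - z)) / 2))"
  proof (rule signed_integral_Fubini[OF d X.finite_borel_measure_M])
    show "(\<lambda>(x, z). (1 + sgn (\<xi> - x - z)) / 2) \<in> borel_measurable (borel \<Otimes>\<^sub>M borel)" by measurable
    show "\<bar>(1 + sgn (\<xi> - x - z)) / 2\<bar> \<le> 1" for x z by (simp add: sgn_if)
  qed
  also have "\<dots> = (LINT z|chi. ?SI (\<lambda>x. sgn (\<xi> - z - x))) / 2"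
    unfolding SI_h by simp
  finally have "(?SI (\<lambda>x. cdf chi (\<xi> - x)) + ?SI (\<lambda>x. measure chi {..<\<xi> - x})) / 2 =
      (LINT z|chi. ?SI (\<lambda>x. sgn (\<xi> - z - x))) / 2" .
  moreover have "deconvolution chi \<mu> \<xi> m = cdf chi \<xi> - ?SI (\<lambda>x. cdf chi (\<xi> - x))"
    by (rule deconvolution_telescope[OF chi \<mu>])
  ultimately show ?thesis
    unfolding ll left_limit_cdf[OF chi] by argo
qed

section \<open>Uniform convergence of truncated sine integrals\<close>

text \<open>
  The Moore-Osgood interchange of limits, with uniformity stated as a Cauchy condition: the
  limit in \<open>n\<close> removes a cut-off, uniformly in \<open>m\<close>, after which \<open>m\<close> may tend to infinity.
\<close>
lemma swap_uniformly_Cauchy_limits: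
  fixes a :: "nat \<Rightarrow> nat \<Rightarrow> real"
  assumes b: "\<And>m. (\<lambda>n. a n m) \<longlonglongrightarrow> b m"
    and A: "\<And>n. (\<lambda>m. a n m) \<longlonglongrightarrow> A n"
    and L: "A \<longlonglongrightarrow> L"
    and unif: "\<And>e. 0 < e \<Longrightarrow> \<exists>n0. \<forall>n\<ge>n0. \<forall>n'\<ge>n. \<forall>m. \<bar>a n' m - a n m\<bar> \<le> e"
  shows "b \<longlonglongrightarrow> L"
proof (rule LIMSEQ_I)
  fix r :: real assume "0 < r"
  then have r: "0 < r / 4" by simp
  obtain n0 where n0: "\<And>n n' m. n0 \<le> n \<Longrightarrow> n \<le> n' \<Longrightarrow> \<bar>a n' m - a n m\<bar> \<le> r / 4"
    using unif[OF r] by blast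
  obtain n1 where n1: "\<And>n. n1 \<le> n \<Longrightarrow> norm (A n - L) < r / 4"
    using LIMSEQ_D[OF L r] by blast
  define n where "n = max n0 n1"
  obtain m0 where m0: "\<And>m. m0 \<le> m \<Longrightarrow> norm (a n m - A n) < r / 4"
    using LIMSEQ_D[OF A r] by blast
  have ba: "\<bar>b m - a n m\<bar> \<le> r / 4" for m
  proof (rule tendsto_upperbound)
    show "(\<lambda>n'. \<bar>a n' m - a n m\<bar>) \<longlonglongrightarrow> \<bar>b m - a n m\<bar>"
      by (intro tendsto_intros b)
    show "\<forall>\<^sub>F n' in sequentially. \<bar>a n' m - a n m\<bar> \<le> r / 4"
      using eventually_ge_at_top[of n] by eventually_elim (rule n0, simp_all add: n_def)
  qed simp
  show "\<exists>m0. \<forall>m\<ge>m0. norm (b m - L) < r"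
  proof (intro exI allI impI)
    fix m assume "m0 \<le> m"
    then have "\<bar>a n m - A n\<bar> < r / 4" "\<bar>A n - L\<bar> < r / 4"
      using m0[of m] n1[of n] by (simp_all add: n_def)
    with ba[of m] show "norm (b m - L) < r"
      unfolding real_norm_def by linarith
  qed
qed

lemma integral_haar_interval_split:
  fixes f :: "real \<Rightarrow> real"
  assumes "0 < a" "a \<le> c" "c \<le> b" and f: "f \<in> borel_measurable borel" "\<And>t. \<bar>f t\<bar> \<le> B"
  shows "(LINT t|haar_interval a b. f t) = (LINT t|haar_interval a c. f t) + (LINT t|haar_interval c b. f t)"
proof -
  interpret H: finite_borel_measure "haar_interval a b"
    by (rule finite_borel_measure_haar_interval[OF assms(1)])
  note [measurable] = f(1)
  have i: "integrable (haar_interval a b) (\<lambda>t. indicator {x<..y} t * f t)" for x y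
    by (rule H.integrable_bounded[where B = "\<bar>B\<bar>"], measurable)
      (use f(2) in \<open>auto simp: indicator_def intro: order_trans[OF _ abs_ge_self]\<close>)
  have "(LINT t|haar_interval a b. f t) = (LINT t|haar_interval a b. indicator {a<..b} t * f t)"
    using integral_haar_subinterval[OF \<open>0 < a\<close> order_refl order_refl f(1), of b] by simp
  also have "\<dots> = (LINT t|haar_interval a b. indicator {a<..c} t * f t + indicator {c<..b} t * f t)"
    using assms(2,3) by (intro Bochner_Integration.integral_cong) (auto simp: indicator_def)
  also have "\<dots> = (LINT t|haar_interval a b. indicator {a<..c} t * f t) + (LINT t|haar_interval a b. indicator {c<..b} t * f t)"
    by (rule Bochner_Integration.integral_add[OF i i])
  also have "\<dots> = (LINT t|haar_interval a c. f t) + (LINT t|haar_interval c b. f t)"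
    using assms by (simp add: integral_haar_subinterval)
  finally show ?thesis .
qed

lemma abs_sine_integral_le_variation:
  assumes "0 < a" "a \<le> b" and P: "continuous_on UNIV P" "\<And>t. \<bar>P t\<bar> \<le> 1"
    and var: "\<And>n t. incseq t \<Longrightarrow> 0 \<le> t 0 \<Longrightarrow> (\<Sum>i<n. \<bar>P (t (Suc i)) - P (t i)\<bar>) \<le> V"
    and small: "\<And>c. c \<in> {a..b} \<Longrightarrow> \<bar>Si (w * c) - Si (w * a)\<bar> \<le> e"
  shows "\<bar>LINT t|haar_interval a b. sin (t * w) * P t\<bar> \<le> e * (1 + V)"
proof -
  have sm: "(\<lambda>t. sin (t * w)) \<in> borel_measurable borel" by measurable
  have Pm: "P \<in> borel_measurable borel" by (rule borel_measurable_continuous_onI[OF P(1)])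
  have "(LINT t|haar_interval a b. sin (t * w) * P t) =
      (LINT t|haar_interval a b. indicator {a<..b} t * (sin (t * w) * P t))"
    by (rule integral_haar_subinterval[symmetric, OF \<open>0 < a\<close>])
      (simp_all only: order_refl, intro borel_measurable_times sm Pm)
  also have "\<bar>\<dots>\<bar> \<le> e * (\<bar>P b\<bar> + V)"
  proof (rule Abel_summation_bounded_variation[OF finite_borel_measure_haar_interval[OF assms(1)] sm _ P assms(2)])
    show "\<bar>sin (x * w)\<bar> \<le> 1" for x by simp
    show "(\<Sum>i<n. \<bar>P (t (Suc i)) - P (t i)\<bar>) \<le> V" if "incseq t" "t 0 = a" for n t
      using var[OF that(1)] that(2) assms(1) by simp
    show "\<bar>LINT x|haar_interval a b. indicator {a<..c} x * sin (x * w)\<bar> \<le> e" if "c \<in> {a..b}" for c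
      using small[OF that] that assms(1)
      by (simp add: integral_haar_subinterval[OF _ _ _ sm] integral_haar_interval_sin)
  qed
  also have "\<dots> \<le> e * (1 + V)"
    using small[of a] assms(2) P(2)[of b] by (intro mult_left_mono) auto
  finally show ?thesis .
qed

text \<open>
  The two pieces by which the truncated integrals differ lie near \<open>0\<close> and near \<open>\<infinity>\<close>, where
  \<open>Si\<close> varies little. The variation bound turns this into a bound that does not depend on \<open>m\<close>.
\<close>
lemma uniformly_Cauchy_sine_integrals:
  fixes P :: "nat \<Rightarrow> real \<Rightarrow> real"
  assumes P: "\<And>m. continuous_on UNIV (P m)" "\<And>m t. \<bar>P m t\<bar> \<le> 1"
    and var: "\<And>m n t. incseq t \<Longrightarrow> 0 \<le> t 0 \<Longrightarrow> (\<Sum>i<n. \<bar>P m (t (Suc i)) - P m (t i)\<bar>) \<le> V"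
    and "0 < e"
  shows "\<exists>n0. \<forall>n\<ge>n0. \<forall>n'\<ge>n. \<forall>m.
    \<bar>(LINT t|haar_interval (1 / real (Suc n')) (real (Suc n')). sin (t * w) * P m t) -
     (LINT t|haar_interval (1 / real (Suc n)) (real (Suc n)). sin (t * w) * P m t)\<bar> \<le> e"
proof -
  have "0 \<le> V" using var[of "\<lambda>_. 0" 0] by (simp add: incseq_def)
  \<comment> \<open>Each of the two pieces contributes at most \<open>\<delta> (1 + V) = e / 2\<close>.\<close>
  define \<delta> where "\<delta> = e / (2 * (1 + V))"
  have "0 < 1 + V" using \<open>0 \<le> V\<close> by linarith
  then have \<delta>: "0 < \<delta>" "\<delta> * (1 + V) = e / 2"
    using \<open>0 < e\<close> by (simp_all add: \<delta>_def field_simps)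
  have d2: "0 < \<delta> / 2" using \<delta>(1) by simp
  obtain T where T: "\<And>c. T \<le> c \<Longrightarrow> dist (Si (w * c)) (pi / 2 * sgn w) < \<delta> / 2"
    using tendstoD[OF Si_mult_at_top d2] unfolding eventually_at_top_linorder by blast
  have "((\<lambda>c. Si (w * c)) \<longlongrightarrow> Si (w * 0)) (at 0)"
    by (intro isCont_tendsto_compose[OF isCont_Si] tendsto_intros)
  then have "\<forall>\<^sub>F c in at 0. dist (Si (w * c)) (Si (w * 0)) < \<delta> / 2"
    using d2 by (rule tendstoD)
  then obtain s where s: "0 < s" "\<And>c. c \<noteq> 0 \<Longrightarrow> \<bar>c\<bar> < s \<Longrightarrow> dist (Si (w * c)) (Si (w * 0)) < \<delta> / 2"
    unfolding eventually_at by (auto simp: dist_real_def)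
  obtain n1 :: nat where n1: "T < n1" using reals_Archimedean2 by blast
  obtain n2 :: nat where n2: "1 / s < n2" using reals_Archimedean2 by blast
  show ?thesis
  proof (intro exI[of _ "max n1 n2"] allI impI)
    fix n n' m assume n: "max n1 n2 \<le> n" "n \<le> n'"
    define u v where "u = real (Suc n)" and "v = real (Suc n')"
    have uv: "0 < u" "0 < v" "u \<le> v" "1 \<le> u" "T < u" "1 / s < u"
      using n n1 n2 by (auto simp: u_def v_def)
    then have "1 / u < s" using s(1) by (simp add: field_simps)
    have ord: "1 / v \<le> 1 / u" "1 / u \<le> u" "0 < 1 / v" "0 < 1 / u"
      using uv by (simp_all add: frac_le divide_le_eq mult_ge1_I)
    let ?I = "\<lambda>a b. LINT t|haar_interval a b. sin (t * w) * P m t"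
    have fm: "(\<lambda>t. sin (t * w) * P m t) \<in> borel_measurable borel"
      by (intro borel_measurable_times borel_measurable_continuous_onI[OF P(1)]) measurable
    have fb: "\<bar>sin (t * w) * P m t\<bar> \<le> 1" for t
      unfolding abs_mult using mult_mono[OF abs_sin_le_one[of "t * w"] P(2)[of m t]] by simp
    have "?I (1 / v) v = ?I (1 / v) (1 / u) + (?I (1 / u) u + ?I u v)"
      using ord uv
      by (subst integral_haar_interval_split[of "1 / v" "1 / u" v, OF _ _ _ fm fb], simp, simp, linarith)
        (subst integral_haar_interval_split[of "1 / u" u v, OF _ _ _ fm fb], simp_all)
    moreover have "\<bar>?I (1 / v) (1 / u)\<bar> \<le> \<delta> * (1 + V)"
    proof (rule abs_sine_integral_le_variation[OF ord(3,1) P var])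
      fix c assume c: "c \<in> {1 / v..1 / u}"
      have "1 / v \<le> c" "c \<le> 1 / u" using c by simp_all
      then have "c \<noteq> 0" "\<bar>c\<bar> < s" "1 / v \<noteq> 0" "\<bar>1 / v\<bar> < s"
        using ord \<open>1 / u < s\<close> by linarith+
      with s(2)[of c] s(2)[of "1 / v"] show "\<bar>Si (w * c) - Si (w * (1 / v))\<bar> \<le> \<delta>"
        unfolding dist_real_def by linarith
    qed
    moreover have "\<bar>?I u v\<bar> \<le> \<delta> * (1 + V)"
    proof (rule abs_sine_integral_le_variation[OF uv(1,3) P var])
      fix c assume "c \<in> {u..v}"
      with uv(5) have "T \<le> c" "T \<le> u" by simp_all
      with T[of c] T[of u] show "\<bar>Si (w * c) - Si (w * u)\<bar> \<le> \<delta>"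
        unfolding dist_real_def by linarith
    qed
    ultimately show "\<bar>(LINT t|haar_interval (1 / real (Suc n')) (real (Suc n')). sin (t * w) * P m t) -
        (LINT t|haar_interval (1 / real (Suc n)) (real (Suc n)). sin (t * w) * P m t)\<bar> \<le> e"
      unfolding u_def[symmetric] v_def[symmetric] \<delta>(2) by linarith
  qed
qed

lemma power_Suc_tendsto_zero_indicator:
  fixes x :: real
  assumes "0 \<le> x" "x \<le> 1"
  shows "(\<lambda>m. (1 - x) ^ Suc m) \<longlonglongrightarrow> (if x = 0 then 1 else 0)"
proof (cases "x = 0")
  case False
  then have "(\<lambda>m. (1 - x) ^ m) \<longlonglongrightarrow> 0"
    using assms by (intro LIMSEQ_realpow_zero) auto
  with False show ?thesis using LIMSEQ_Suc by fastforce
qed simp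

section \<open>The Fourier integrals as sine integrals\<close>

text \<open>
  Extends \<open>T \<mapsto> Si (w T)\<close> to \<open>T = \<infinity>\<close> by its limit, so that one formula covers finite, infinite and
  degenerate intervals.
\<close>
definition Si_ext :: "real \<Rightarrow> ereal \<Rightarrow> real" where
  "Si_ext w T = (if T = \<infinity> then pi / 2 * sgn w else Si (w * real_of_ereal T))"

lemma Si_ext_ereal [simp]: "Si_ext w (ereal b) = Si (w * b)"
  and Si_ext_infinity [simp]: "Si_ext w \<infinity> = pi / 2 * sgn w"
  by (simp_all add: Si_ext_def)

lemma measurable_Si_ext: "(\<lambda>w. Si_ext w T) \<in> borel_measurable borel"
  unfolding Si_ext_def by measurable

lemma bounded_Si_ext: "\<exists>B. \<forall>w T. \<bar>Si_ext w T\<bar> \<le> B"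
proof -
  obtain B where B: "\<And>x. \<bar>Si x\<bar> \<le> B" using bounded_Si by blast
  have "\<bar>Si_ext w T\<bar> \<le> max B (pi / 2)" for w T
    using B[of "w * real_of_ereal T"] by (auto simp: Si_ext_def abs_mult abs_sgn_eq max_def)
  then show ?thesis by blast
qed

lemma integral_haar_sin_indicator_Icc:
  assumes "0 < a" "a \<le> s" "s \<le> r" "r \<le> b"
  shows "(LINT t|haar_interval a b. sin (t * w) * indicator {s..r} t) = Si (w * r) - Si (w * s)"
proof -
  have sm: "(\<lambda>t. sin (t * w)) \<in> borel_measurable borel" by measurable
  have "(LINT t|haar_interval a b. sin (t * w) * indicator {s..r} t) =
      (LINT t|lborel. indicator {a<..b} t / t * (sin (t * w) * indicator {s..r} t))"
    by (rule integral_haar_interval[OF assms(1)]) measurable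
  also have "\<dots> = (LINT t|lborel. indicator {s<..r} t / t * sin (t * w))"
  proof (rule integral_cong_AE)
    show "AE t in lborel. indicator {a<..b} t / t * (sin (t * w) * indicator {s..r} t) =
        indicator {s<..r} t / t * sin (t * w)"
      using AE_lborel_singleton[of s]
      by eventually_elim (use assms in \<open>auto simp: indicator_def\<close>)
  qed measurable
  also have "\<dots> = (LINT t|haar_interval s r. sin (t * w))"
    using assms by (intro integral_haar_interval[symmetric] sm) simp
  also have "\<dots> = Si (w * r) - Si (w * s)"
    using assms by (intro integral_haar_interval_sin) simp_all
  finally show ?thesis .
qed

text \<open>
  For finite \<open>T\<close> the integrals become constant once the cut-offs pass \<open>S\<close> and \<open>T\<close>; for
  \<open>T = \<infinity>\<close> they converge because \<open>Si\<close> does. If also \<open>S = \<infinity>\<close>, the set of integration is empty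
  and both sides vanish.
\<close>
lemma haar_sin_indicator_tendsto:
  assumes "0 < S" "S \<le> T"
  shows "(\<lambda>n. LINT t|haar_interval (1 / real (Suc n)) (real (Suc n)).
            sin (t * w) * indicator {t. S \<le> ereal t \<and> ereal t \<le> T} t)
    \<longlonglongrightarrow> Si_ext w T - Si_ext w S"
proof (cases S)
  case PInf
  with assms show ?thesis by simp
next
  case MInf
  with assms show ?thesis by simp
next
  case (real s)
  with assms have s: "0 < s" by simp
  obtain n1 :: nat where n1: "1 / s < n1" using reals_Archimedean2 by blast
  have ns: "1 / real (Suc n) \<le> s" if "n1 \<le> n" for n
  proof -
    have "1 / s < real (Suc n)" using n1 that by simp
    with s show ?thesis by (simp add: field_simps)
  qed
  show ?thesis
  proof (cases T)
    case MInf
    with assms real show ?thesis by simp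
  next
    case (real b)
    with assms \<open>S = ereal s\<close> have b: "s \<le> b" by simp
    obtain n2 :: nat where n2: "b < n2" using reals_Archimedean2 by blast
    have "\<forall>\<^sub>F n in sequentially. (LINT t|haar_interval (1 / real (Suc n)) (real (Suc n)).
        sin (t * w) * indicator {t. S \<le> ereal t \<and> ereal t \<le> T} t) = Si_ext w T - Si_ext w S"
      using eventually_ge_at_top[of "max n1 n2"]
    proof eventually_elim
      case (elim n)
      have "{t. S \<le> ereal t \<and> ereal t \<le> T} = {s..b}" using real \<open>S = ereal s\<close> by auto
      moreover have "b \<le> real (Suc n)" using n2 elim by simp
      ultimately show ?case
        using integral_haar_sin_indicator_Icc[OF _ ns b, of n "real (Suc n)" w] elim real \<open>S = ereal s\<close> by simp
    qed
    then show ?thesis by (rule tendsto_eventually)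
  next
    case PInf
    obtain n2 :: nat where n2: "s < n2" using reals_Archimedean2 by blast
    have "\<forall>\<^sub>F n in sequentially. Si (w * real (Suc n)) - Si (w * s) =
        (LINT t|haar_interval (1 / real (Suc n)) (real (Suc n)).
        sin (t * w) * indicator {t. S \<le> ereal t \<and> ereal t \<le> T} t)"
      using eventually_ge_at_top[of "max n1 n2"]
    proof eventually_elim
      case (elim n)
      have pos: "0 < 1 / real (Suc n)" by simp
      have sn: "s \<le> real (Suc n)" using n2 elim by simp
      have set: "{t. S \<le> ereal t \<and> ereal t \<le> T} = {s..}" using PInf \<open>S = ereal s\<close> by auto
      have "(LINT t|haar_interval (1 / real (Suc n)) (real (Suc n)). sin (t * w) * indicator {s..} t) =
          (LINT t|haar_interval (1 / real (Suc n)) (real (Suc n)). sin (t * w) * indicator {s..real (Suc n)} t)"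
      proof -
        have m: "(\<lambda>t. sin (t * w) * indicator {s..} t) \<in> borel_measurable borel"
          "(\<lambda>t. sin (t * w) * indicator {s..real (Suc n)} t) \<in> borel_measurable borel"
          by measurable
        show ?thesis
          unfolding integral_haar_interval[OF pos m(1)] integral_haar_interval[OF pos m(2)]
          by (rule Bochner_Integration.integral_cong) (auto simp: indicator_def)
      qed
      also have "\<dots> = Si (w * real (Suc n)) - Si (w * s)"
        by (rule integral_haar_sin_indicator_Icc[OF pos ns sn order_refl]) (use elim in simp)
      finally show ?case unfolding set by (rule sym)
    qed
    moreover have "(\<lambda>n. Si (w * real (Suc n)) - Si (w * s)) \<longlonglongrightarrow> pi / 2 * sgn w - Si (w * s)"
      by (intro tendsto_diff tendsto_const
        filterlim_compose[OF Si_mult_at_top filterlim_compose[OF filterlim_real_sequentially filterlim_Suc]])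
    ultimately have "(\<lambda>n. LINT t|haar_interval (1 / real (Suc n)) (real (Suc n)).
        sin (t * w) * indicator {t. S \<le> ereal t \<and> ereal t \<le> T} t) \<longlonglongrightarrow> pi / 2 * sgn w - Si (w * s)"
      by (rule Lim_transform_eventually[rotated])
    then show ?thesis using PInf \<open>S = ereal s\<close> by simp
  qed
qed

lemma char_minus: "char M (- t) = cnj (char M t)"
proof -
  have "(CLINT x|M. iexp (- t * x)) = (CLINT x|M. cnj (iexp (t * x)))"
    by (rule Bochner_Integration.integral_cong) (simp_all add: exp_cnj)
  then show ?thesis unfolding char_def by (simp only: Bochner_Integration.integral_cnj)
qed

text \<open>
  The integrand at \<open>-t\<close> is the conjugate of the integrand at \<open>t\<close>, so folding the two half-lines
  leaves twice the real part on \<open>[s, R]\<close>. This real part is a sine transform of \<open>chi\<close>, and Fubini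
  against \<open>dt / t\<close> yields sine integrals.
\<close>
lemma truncated_fourier_Psi_Si:
  assumes chi: "real_distribution chi" and sR: "0 < s" "s \<le> R"
  shows "truncated_fourier_Psi chi (ereal s) (ereal R) (- \<xi>) =
    complex_of_real (- (1 / pi) * (LINT z|chi. Si ((\<xi> - z) * R) - Si ((\<xi> - z) * s)))"
proof -
  interpret X: real_distribution chi by fact
  define F where "F t = exp (\<i> * of_real (- \<xi> * t)) * (char chi t / (2 * of_real pi * \<i> * of_real t))" for t
  define v where "v t = (LINT z|chi. sin (t * (\<xi> - z)))" for t
  have Fm [measurable]: "F \<in> borel_measurable borel"
    unfolding F_def by measurable
  have FB: "norm (F t) \<le> 1 / (2 * pi * s)" if "t \<in> {s..R}" for t
  proof -
    have "norm (F t) = norm (char chi t) / (2 * pi * t)"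
      using that sR unfolding F_def by (simp add: norm_mult norm_divide)
    also have "\<dots> \<le> 1 / (2 * pi * s)"
      using that sR X.cmod_char_le_1[of t] by (intro frac_le) auto
    finally show ?thesis .
  qed
  \<comment> \<open>The symmetry that makes the folded integrand real.\<close>
  have F_minus: "F (- t) = cnj (F t)" for t
    unfolding F_def by (simp add: char_minus exp_cnj)
  have FB': "norm (F (- t)) \<le> 1 / (2 * pi * s)" if "t \<in> {s..R}" for t
    using FB[OF that] unfolding F_minus by simp
  have Re_i: "Re (z * (- \<i> / of_real c)) = Im z / c" for z c
    unfolding times_divide_eq_right Re_divide_of_real by simp
  have F_sum: "F t + F (- t) = complex_of_real (- (1 / pi) * (1 / t * v t))" if "0 < t" for t
  proof -
    have "F t = exp (\<i> * of_real (- \<xi> * t)) * char chi t * (- \<i> / of_real (2 * pi * t))"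
      using that by (simp add: F_def field_simps)
    then have "Re (F t) = Im (exp (\<i> * of_real (- \<xi> * t)) * char chi t) / (2 * pi * t)"
      by (simp only: Re_i)
    also have "Im (exp (\<i> * of_real (- \<xi> * t)) * char chi t) = - v t"
      unfolding v_def char_sin_integral[OF chi] by (simp add: Im_exp Re_exp mult.commute)
    finally have "2 * Re (F t) = - (1 / pi) * (1 / t * v t)"
      using that by (simp add: field_simps)
    then show ?thesis
      unfolding F_minus complex_add_cnj by simp
  qed
  have i1: "integrable lborel (\<lambda>t. indicator {s..R} t *\<^sub>R F t)"
    by (rule integrableI_bounded_set_indicator[where B = "1 / (2 * pi * s)"])
      (use FB sR(2) in \<open>auto intro!: AE_I2\<close>)
  have i2: "integrable lborel (\<lambda>t. indicator {s..R} t *\<^sub>R F (- t))"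
    by (rule integrableI_bounded_set_indicator[where B = "1 / (2 * pi * s)"])
      (use FB' sR(2) in \<open>auto intro!: AE_I2\<close>)
  have i2': "integrable lborel (\<lambda>t. indicator {s..R} (- t) *\<^sub>R F t)"
    using lborel_integrable_real_affine[OF i2, of "- 1" 0] by simp
  have "truncated_fourier_Psi chi (ereal s) (ereal R) (- \<xi>) =
      (CLINT t|lborel. indicator {t. s \<le> \<bar>t\<bar> \<and> \<bar>t\<bar> \<le> R} t *\<^sub>R F t)"
    unfolding truncated_fourier_Psi_def set_lebesgue_integral_def F_def by simp
  also have "\<dots> = (CLINT t|lborel. indicator {s..R} t *\<^sub>R F t + indicator {s..R} (- t) *\<^sub>R F t)"
    using sR by (intro Bochner_Integration.integral_cong) (auto simp: indicator_def)
  also have "\<dots> = (CLINT t|lborel. indicator {s..R} t *\<^sub>R F t) + (CLINT t|lborel. indicator {s..R} (- t) *\<^sub>R F t)"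
    by (rule Bochner_Integration.integral_add[OF i1 i2'])
  also have "(CLINT t|lborel. indicator {s..R} (- t) *\<^sub>R F t) = (CLINT t|lborel. indicator {s..R} t *\<^sub>R F (- t))"
    using lborel_integral_real_affine[of "- 1" "\<lambda>t. indicator {s..R} (- t) *\<^sub>R F t" 0] by simp
  also have "(CLINT t|lborel. indicator {s..R} t *\<^sub>R F t) + \<dots> =
      (CLINT t|lborel. indicator {s..R} t *\<^sub>R F t + indicator {s..R} t *\<^sub>R F (- t))"
    by (rule Bochner_Integration.integral_add[OF i1 i2, symmetric])
  also have "\<dots> = (CLINT t|lborel. complex_of_real (- (1 / pi) * (indicator {s..R} t / t * v t)))"
  proof (rule Bochner_Integration.integral_cong[OF refl])
    fix t
    show "indicator {s..R} t *\<^sub>R F t + indicator {s..R} t *\<^sub>R F (- t) =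
        complex_of_real (- (1 / pi) * (indicator {s..R} t / t * v t))"
      using F_sum[of t] sR by (cases "t \<in> {s..R}") (simp_all only: indicator_simps scaleR_one scaleR_zero_left
          atLeastAtMost_iff, auto)
  qed
  also have "\<dots> = complex_of_real (LINT t|lborel. - (1 / pi) * (indicator {s..R} t / t * v t))"
    by (rule integral_complex_of_real)
  also have "\<dots> = complex_of_real (- (1 / pi) * (LINT t|lborel. indicator {s..R} t / t * v t))"
    by (simp only: integral_mult_right_zero)
  also have "(LINT t|lborel. indicator {s..R} t / t * v t) =
      (LINT z|chi. Si ((\<xi> - z) * R) - Si ((\<xi> - z) * s))"
  proof -
    have m: "(\<lambda>(t, z). sin (t * (\<xi> - z))) \<in> borel_measurable (borel \<Otimes>\<^sub>M borel)" by measurable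
    have vm [measurable]: "v \<in> borel_measurable borel"
      unfolding v_def using measurable_LINT_bounded[OF X.finite_borel_measure_M m] by simp
    have "(LINT t|lborel. indicator {s..R} t / t * v t) = (LINT t|lborel. indicator {s<..R} t / t * v t)"
    proof (rule integral_cong_AE)
      show "AE t in lborel. indicator {s..R} t / t * v t = indicator {s<..R} t / t * v t"
        using AE_lborel_singleton[of s] by eventually_elim (auto simp: indicator_def)
    qed measurable
    also have "\<dots> = (LINT t|haar_interval s R. v t)"
      by (rule integral_haar_interval[symmetric, OF sR(1) vm])
    also have "\<dots> = (LINT z|chi. LINT t|haar_interval s R. sin (t * (\<xi> - z)))"
      unfolding v_def
      by (rule Fubini_bounded[OF finite_borel_measure_haar_interval[OF sR(1)] X.finite_borel_measure_M m, where B = 1]) simp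
    finally show ?thesis
      unfolding integral_haar_interval_sin[OF sR] .
  qed
  finally show ?thesis .
qed

text \<open>
  Folding comes before the limit \<open>T = \<infinity>\<close>: the limit exists for the symmetric integral because
  \<open>Si\<close> is bounded and converges, whereas an atom of \<open>chi\<close> at \<open>\<xi>\<close> makes each half-line diverge.
\<close>
lemma fourier_Psi_Si_ext:
  assumes chi: "real_distribution chi" and "0 < S" "S \<le> T"
  shows "fourier_Psi chi S T (- \<xi>) =
    complex_of_real (- (1 / pi) * (LINT z|chi. Si_ext (\<xi> - z) T - Si_ext (\<xi> - z) S))"
proof (cases S)
  case PInf
  then have "T = \<infinity>" using assms by simp
  have "truncated_fourier_Psi chi S (ereal R) (- \<xi>) = 0" for R
    unfolding truncated_fourier_Psi_def set_lebesgue_integral_def PInf by simp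
  then show ?thesis
    unfolding fourier_Psi_def PInf \<open>T = \<infinity>\<close> by (simp add: tendsto_Lim)
next
  case MInf
  with assms show ?thesis by simp
next
  case (real s)
  with assms have s: "0 < s" by simp
  interpret X: real_distribution chi by fact
  show ?thesis
  proof (cases T)
    case MInf
    with assms real show ?thesis by simp
  next
    case (real b)
    with assms \<open>S = ereal s\<close> have b: "s \<le> b" by simp
    show ?thesis
      using truncated_fourier_Psi_Si[OF chi s b] real \<open>S = ereal s\<close> by (simp add: fourier_Psi_def)
  next
    case PInf
    obtain B where B: "\<And>x. \<bar>Si x\<bar> \<le> B" using bounded_Si by blast
    have "((\<lambda>R. LINT z|chi. Si ((\<xi> - z) * R) - Si ((\<xi> - z) * s)) \<longlongrightarrow>
        (LINT z|chi. pi / 2 * sgn (\<xi> - z) - Si ((\<xi> - z) * s))) at_top"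
    proof (rule integral_dominated_convergence_at_top[where w = "\<lambda>_. 2 * B"])
      have "\<bar>Si ((\<xi> - z) * R) - Si ((\<xi> - z) * s)\<bar> \<le> 2 * B" for z R
        using B[of "(\<xi> - z) * R"] B[of "(\<xi> - z) * s"] by linarith
      then show "\<forall>\<^sub>F R in at_top. AE z in chi. norm (Si ((\<xi> - z) * R) - Si ((\<xi> - z) * s)) \<le> 2 * B"
        by simp
      show "AE z in chi. ((\<lambda>R. Si ((\<xi> - z) * R) - Si ((\<xi> - z) * s)) \<longlongrightarrow> pi / 2 * sgn (\<xi> - z) - Si ((\<xi> - z) * s)) at_top"
        by (intro AE_I2 tendsto_diff tendsto_const Si_mult_at_top)
    qed (simp_all, measurable)
    then have "((\<lambda>R. complex_of_real (- (1 / pi) * (LINT z|chi. Si ((\<xi> - z) * R) - Si ((\<xi> - z) * s)))) \<longlongrightarrow>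
        complex_of_real (- (1 / pi) * (LINT z|chi. pi / 2 * sgn (\<xi> - z) - Si ((\<xi> - z) * s)))) at_top"
      by (intro tendsto_intros)
    moreover have "\<forall>\<^sub>F R in at_top. complex_of_real (- (1 / pi) * (LINT z|chi. Si ((\<xi> - z) * R) - Si ((\<xi> - z) * s))) =
        truncated_fourier_Psi chi S (ereal R) (- \<xi>)"
      using eventually_ge_at_top[of s]
      by eventually_elim (simp only: truncated_fourier_Psi_Si[OF chi s] \<open>S = ereal s\<close>)
    ultimately have "((\<lambda>R. truncated_fourier_Psi chi S (ereal R) (- \<xi>)) \<longlongrightarrow>
        complex_of_real (- (1 / pi) * (LINT z|chi. pi / 2 * sgn (\<xi> - z) - Si ((\<xi> - z) * s)))) at_top"
      by (rule Lim_transform_eventually)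
    then have "Lim at_top (\<lambda>R. truncated_fourier_Psi chi S (ereal R) (- \<xi>)) =
        complex_of_real (- (1 / pi) * (LINT z|chi. pi / 2 * sgn (\<xi> - z) - Si ((\<xi> - z) * s)))"
      by (intro tendsto_Lim) simp_all
    then show ?thesis
      unfolding fourier_Psi_def using PInf \<open>S = ereal s\<close> by simp
  qed
qed

lemma variation_on_nat_sequence:
  assumes "variation_on f A \<le> ennreal V" "0 \<le> V" and "incseq t" "range t \<subseteq> A"
  shows "(\<Sum>i<n. norm (f (t (Suc i)) - f (t i))) \<le> V"
proof -
  define ts where "ts = map t [0..<Suc n]"
  have "sorted ts"
    unfolding ts_def using incseqD[OF assms(3)] by (auto simp: sorted_iff_nth_mono simp del: upt_Suc)
  moreover have "set ts \<subseteq> A" using assms(4) by (auto simp: ts_def)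
  ultimately have "(\<Sum>i<length ts - 1. ennreal (norm (f (ts ! Suc i) - f (ts ! i)))) \<le> variation_on f A"
    unfolding variation_on_def by (intro SUP_upper) simp
  also have "(\<Sum>i<length ts - 1. ennreal (norm (f (ts ! Suc i) - f (ts ! i)))) =
      (\<Sum>i<n. ennreal (norm (f (t (Suc i)) - f (t i))))"
    unfolding ts_def by (intro sum.cong) (auto simp del: upt_Suc)
  also have "\<dots> = ennreal (\<Sum>i<n. norm (f (t (Suc i)) - f (t i)))"
    by (rule sum_ennreal) simp
  finally show ?thesis
    using assms(1,2) by (meson ennreal_le_iff order_trans)
qed

section \<open>The limit of the deconvolution function\<close>

lemma char_zeros_ereal [simp]: "ereal t \<in> char_zeros M \<longleftrightarrow> char M t = 0"
  by (simp add: char_zeros_def)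

text \<open>
  The powers \<open>(1 - \<Phi>)\<^sup>m\<close> tend boundedly to the indicator of the zeros of \<open>\<Phi>\<close>: they are
  constantly \<open>1\<close> at a zero, and geometric with ratio in \<open>[0, 1)\<close> elsewhere.
\<close>
lemma sine_integrals_of_powers_tendsto:
  fixes \<Phi> :: "real \<Rightarrow> real"
  assumes \<Phi>: "continuous_on UNIV \<Phi>" "\<And>t. 0 \<le> \<Phi> t" "\<And>t. \<Phi> t \<le> 1"
    and "0 < a"
  shows "(\<lambda>m. LINT t|haar_interval a b. sin (t * w) * (1 - \<Phi> t) ^ Suc m)
    \<longlonglongrightarrow> (LINT t|haar_interval a b. sin (t * w) * indicator {t. \<Phi> t = 0} t)"
proof -
  interpret H: finite_borel_measure "haar_interval a b"
    by (rule finite_borel_measure_haar_interval[OF assms(4)])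
  have [measurable]: "\<Phi> \<in> borel_measurable borel" by (rule borel_measurable_continuous_onI[OF \<Phi>(1)])
  note meas = measurable_cong_sets[OF H.M_is_borel refl, of "borel :: real measure"]
  show ?thesis
  proof (rule integral_dominated_convergence[where w = "\<lambda>_. 1"])
    show "(\<lambda>t. sin (t * w) * indicator {t. \<Phi> t = 0} t) \<in> borel_measurable (haar_interval a b)"
      "(\<lambda>t. sin (t * w) * (1 - \<Phi> t) ^ Suc m) \<in> borel_measurable (haar_interval a b)" for m
      unfolding meas by measurable
    show "AE t in haar_interval a b. (\<lambda>m. sin (t * w) * (1 - \<Phi> t) ^ Suc m)
        \<longlonglongrightarrow> sin (t * w) * indicator {t. \<Phi> t = 0} t"
    proof (intro AE_I2 tendsto_mult tendsto_const)
      fix t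
      show "(\<lambda>m. (1 - \<Phi> t) ^ Suc m) \<longlonglongrightarrow> indicator {t. \<Phi> t = 0} t"
        using power_Suc_tendsto_zero_indicator[OF \<Phi>(2,3), of t] by (simp only: indicator_def mem_Collect_eq of_bool_def)
    qed
    have le: "norm (sin (t * w) * (1 - \<Phi> t) ^ Suc m) \<le> 1" for t m
    proof -
      have "\<bar>(1 - \<Phi> t) ^ Suc m\<bar> \<le> 1"
        unfolding power_abs by (rule power_le_one) (use \<Phi>(2,3)[of t] in auto)
      then show ?thesis
        unfolding real_norm_def abs_mult
        using mult_mono[OF abs_sin_le_one[of "t * w"], of "\<bar>(1 - \<Phi> t) ^ Suc m\<bar>" 1] by simp
    qed
    show "AE t in haar_interval a b. norm (sin (t * w) * (1 - \<Phi> t) ^ Suc m) \<le> 1" for m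
      by (rule AE_I2) (rule le)
  qed simp
qed

text \<open>
  Extracts from the variation on the extended half-line the bound on finite nonnegative points,
  in the form in which Abel summation uses it.
\<close>
lemma variation_decon_power:
  assumes real: "\<And>t. char \<mu> t \<in> \<real>"
    and fin: "(SUP m. variation_on (\<lambda>t. decon_power \<mu> t m) {0..\<infinity>}) < \<infinity>"
  obtains V :: real where "\<And>m n t. incseq t \<Longrightarrow> 0 \<le> t 0 \<Longrightarrow>
    (\<Sum>i<n. \<bar>(1 - Re (char \<mu> (t (Suc i)))) ^ Suc m - (1 - Re (char \<mu> (t i))) ^ Suc m\<bar>) \<le> V"
proof -
  define V where "V = enn2real (SUP m. variation_on (\<lambda>t. decon_power \<mu> t m) {0..\<infinity>})"
  have V: "variation_on (\<lambda>t. decon_power \<mu> t m) {0..\<infinity>} \<le> ennreal V" for m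
  proof -
    have "variation_on (\<lambda>t. decon_power \<mu> t m) {0..\<infinity>} \<le>
        (SUP m. variation_on (\<lambda>t. decon_power \<mu> t m) {0..\<infinity>})"
      by (rule SUP_upper) simp
    also have "\<dots> = ennreal V"
      using fin unfolding V_def infinity_ennreal_def by (rule ennreal_enn2real[symmetric])
    finally show ?thesis .
  qed
  have power: "decon_power \<mu> (ereal t) m = complex_of_real ((1 - Re (char \<mu> t)) ^ Suc m)" for t m
    using real[of t] by (simp add: decon_power_def char_ext_def of_real_Re)
  show thesis
  proof (rule that[of V])
    fix m n and t :: "nat \<Rightarrow> real" assume t: "incseq t" "0 \<le> t 0"
    have "(\<Sum>i<n. norm (decon_power \<mu> (ereal (t (Suc i))) m - decon_power \<mu> (ereal (t i)) m)) \<le> V"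
    proof (rule variation_on_nat_sequence[OF V, of "\<lambda>i. ereal (t i)"])
      show "range (\<lambda>i. ereal (t i)) \<subseteq> {0..\<infinity>}"
        using incseqD[OF t(1), of 0] t(2) by (force intro: order_trans)
    qed (use t in \<open>auto simp: V_def incseq_def\<close>)
    then show "(\<Sum>i<n. \<bar>(1 - Re (char \<mu> (t (Suc i)))) ^ Suc m - (1 - Re (char \<mu> (t i))) ^ Suc m\<bar>) \<le> V"
      unfolding power of_real_diff[symmetric] norm_of_real .
  qed
qed

text \<open>
  The strict inequality at even indices separates consecutive intervals, so indicators add up
  without overlap.
\<close>
lemma interval_partition_indicator:
  fixes \<tau> :: "nat \<Rightarrow> ereal"
  assumes odd: "\<And>k. k \<in> {1..2*K} \<Longrightarrow> odd k \<Longrightarrow> \<tau> k \<le> \<tau> (k + 1)"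
    and even: "\<And>k. k \<in> {1..2*K} \<Longrightarrow> even k \<Longrightarrow> k < 2*K \<Longrightarrow> \<tau> k < \<tau> (k + 1)"
  shows "indicator (\<Union>k\<in>{1..K}. {\<tau> (2*k - 1)..\<tau> (2*k)}) x =
    (\<Sum>k=1..K. indicator {\<tau> (2*k - 1)..\<tau> (2*k)} x :: real)"
proof (rule indicator_UN_disjoint)
  have mono: "\<tau> i \<le> \<tau> j" if "1 \<le> i" "i \<le> j" "j \<le> 2 * K" for i j
    using that(2,1,3)
  proof (induction j rule: dec_induct)
    case (step n)
    have "\<tau> n \<le> \<tau> (Suc n)"
      using odd[of n] even[of n] step by (cases "even n") auto
    with step show ?case by auto
  qed simp
  have "{\<tau> (2*j - 1)..\<tau> (2*j)} \<inter> {\<tau> (2*k - 1)..\<tau> (2*k)} = {}"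
    if "1 \<le> j" "j < k" "k \<le> K" for j k
  proof -
    have "\<tau> (2*j) < \<tau> (2*j + 1)" by (rule even) (use that in auto)
    also have "\<dots> \<le> \<tau> (2*k - 1)" by (rule mono) (use that in auto)
    finally show ?thesis by auto
  qed
  then show "disjoint_family_on (\<lambda>k. {\<tau> (2*k - 1)..\<tau> (2*k)}) {1..K}"
    unfolding disjoint_family_on_def by (metis atLeastAtMost_iff inf_commute linorder_neqE_nat)
qed simp

lemma Si_ext_combination_tendsto:
  fixes \<tau> :: "nat \<Rightarrow> ereal"
  assumes Z: "\<And>t. 0 < t \<Longrightarrow> indicator Z t = (\<Sum>k\<in>I. indicator {S k..T k} (ereal t) :: real)"
    and ST: "\<And>k. k \<in> I \<Longrightarrow> 0 < S k" "\<And>k. k \<in> I \<Longrightarrow> S k \<le> T k"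
    and [measurable]: "Z \<in> sets borel"
  shows "(\<lambda>n. LINT t|haar_interval (1 / real (Suc n)) (real (Suc n)). sin (t * w) * indicator Z t)
    \<longlonglongrightarrow> (\<Sum>k\<in>I. Si_ext w (T k) - Si_ext w (S k))"
proof -
  have Im [measurable]: "{t. S k \<le> ereal t \<and> ereal t \<le> T k} \<in> sets borel" for k
    by measurable
  have "(LINT t|haar_interval (1 / real (Suc n)) (real (Suc n)). sin (t * w) * indicator Z t) =
      (\<Sum>k\<in>I. (LINT t|haar_interval (1 / real (Suc n)) (real (Suc n)).
        sin (t * w) * indicator {t. S k \<le> ereal t \<and> ereal t \<le> T k} t))" for n
  proof -
    have pos: "0 < 1 / real (Suc n)" by simp
    interpret H: finite_borel_measure "haar_interval (1 / real (Suc n)) (real (Suc n))"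
      by (rule finite_borel_measure_haar_interval[OF pos])
    have m: "(\<lambda>t. sin (t * w) * indicator Z t) \<in> borel_measurable borel"
      "(\<lambda>t. \<Sum>k\<in>I. sin (t * w) * indicator {t. S k \<le> ereal t \<and> ereal t \<le> T k} t) \<in> borel_measurable borel"
      "(\<lambda>t. sin (t * w) * indicator {t. S k \<le> ereal t \<and> ereal t \<le> T k} t) \<in> borel_measurable borel" for k
      by measurable
    have "(LINT t|haar_interval (1 / real (Suc n)) (real (Suc n)). sin (t * w) * indicator Z t) =
      (LINT t|haar_interval (1 / real (Suc n)) (real (Suc n)).
        (\<Sum>k\<in>I. sin (t * w) * indicator {t. S k \<le> ereal t \<and> ereal t \<le> T k} t))"
      unfolding integral_haar_interval[OF pos m(1)] integral_haar_interval[OF pos m(2)]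
    proof (rule Bochner_Integration.integral_cong[OF refl])
      fix t
      show "indicator {1 / real (Suc n)<..real (Suc n)} t / t * (sin (t * w) * indicator Z t) =
        indicator {1 / real (Suc n)<..real (Suc n)} t / t *
          (\<Sum>k\<in>I. sin (t * w) * indicator {t. S k \<le> ereal t \<and> ereal t \<le> T k} t)"
      proof (cases "1 / real (Suc n) < t")
        case True
        with pos have "0 < t" by linarith
        moreover have "indicator {t. S k \<le> ereal t \<and> ereal t \<le> T k} t = (indicator {S k..T k} (ereal t) :: real)" for k
          by (simp add: indicator_def)
        ultimately show ?thesis
          by (simp only: Z sum_distrib_left)
      qed (simp add: indicator_def)
    qed
    also have "\<dots> = (\<Sum>k\<in>I. (LINT t|haar_interval (1 / real (Suc n)) (real (Suc n)).
        sin (t * w) * indicator {t. S k \<le> ereal t \<and> ereal t \<le> T k} t))"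
      by (intro Bochner_Integration.integral_sum H.integrable_bounded[OF m(3), where B = 1])
        (auto simp: indicator_def)
    finally show ?thesis .
  qed
  then show ?thesis
    by (simp only:) (intro tendsto_sum haar_sin_indicator_tendsto ST)
qed

lemma null_interval_endpoints_eq:
  assumes "emeasure lborel {t. ereal t \<in> Z} = 0" "{t. ereal t \<in> Z} \<in> sets borel"
    and "{S..T} \<subseteq> Z" "0 < S" "S \<le> T"
  shows "S = T"
proof (rule ccontr)
  assume "S \<noteq> T"
  with assms have "S < T" by simp
  with \<open>0 < S\<close> obtain s where s: "S = ereal s" by (cases S) auto
  obtain b where b: "S < ereal b" "ereal b < T" using ereal_dense2[OF \<open>S < T\<close>] by blast
  have "{s..b} \<subseteq> {t. ereal t \<in> Z}"
  proof
    fix t assume t: "t \<in> {s..b}"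
    have "ereal t \<le> T" using t order.strict_implies_order[OF b(2)]
      by (intro order_trans[of "ereal t" "ereal b" T]) simp_all
    moreover have "S \<le> ereal t" using t s by simp
    ultimately have "ereal t \<in> {S..T}" by (simp only: atLeastAtMost_iff)
    with assms(3) show "t \<in> {t. ereal t \<in> Z}" by (simp only: mem_Collect_eq subsetD)
  qed
  then have "emeasure lborel {s..b} \<le> emeasure lborel {t. ereal t \<in> Z}"
    using assms(2) by (intro emeasure_mono) simp_all
  with assms(1) s b show False by simp
qed

theorem theorem6p4:
  fixes chi \<mu> \<mu>' :: "real measure" and K :: nat and \<tau> :: "nat \<Rightarrow> ereal"
  assumes "real_distribution chi" and "real_distribution \<mu>"
    and "symmetrization \<mu> \<mu>'"
    and "\<exists>L. (char \<mu>' \<longlongrightarrow> L) at_top"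
    and "(SUP m. variation_on (\<lambda>t. decon_power \<mu>' t m) {0..\<infinity>}) < \<infinity>"
    and "1 \<le> K"
    and "\<And>k. k \<in> {1..2*K} \<Longrightarrow> \<tau> k \<in> char_zeros \<mu> \<inter> {0..\<infinity>}"
    and "\<And>k. k \<in> {1..2*K} \<Longrightarrow> odd k \<Longrightarrow>
           \<tau> k \<le> \<tau> (k + 1) \<and> {\<tau> k..\<tau> (k + 1)} \<subseteq> char_zeros \<mu>"
    and "\<And>k. k \<in> {1..2*K} \<Longrightarrow> even k \<Longrightarrow> k < 2*K \<Longrightarrow> \<tau> k < \<tau> (k + 1)"
    and "char_zeros \<mu> \<inter> {0..\<infinity>} = (\<Union>k\<in>{1..K}. {\<tau> (2*k - 1)..\<tau> (2*k)})"
  shows "(\<forall>\<xi>. (\<lambda>m. complex_of_real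
              ((deconvolution chi \<mu>' \<xi> m + left_limit (\<lambda>x. deconvolution chi \<mu>' x m) \<xi>) / 2))
            \<longlonglongrightarrow> complex_of_real ((cdf chi \<xi> + left_limit (cdf chi) \<xi>) / 2)
              + (\<Sum>k=1..K. fourier_Psi chi (\<tau> (2*k - 1)) (\<tau> (2*k)) (- \<xi>)))
       \<and> (emeasure lborel {t. ereal t \<in> char_zeros \<mu>} = 0
            \<longrightarrow> (\<forall>\<xi>. (\<Sum>k=1..K. fourier_Psi chi (\<tau> (2*k - 1)) (\<tau> (2*k)) (- \<xi>)) = 0))"
proof -
  note chi = assms(1)
  interpret X: real_distribution chi by fact
  interpret M: real_distribution \<mu> by fact
  have \<mu>': "real_distribution \<mu>'" and real: "\<And>t. char \<mu>' t \<in> \<real>"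
    and range: "\<And>t. 0 \<le> Re (char \<mu>' t)" "\<And>t. Re (char \<mu>' t) \<le> 1"
    and zeros: "char_zeros \<mu>' = char_zeros \<mu>"
    using assms(3) unfolding symmetrization_def by blast+
  interpret M': real_distribution \<mu>' by (rule \<mu>')
  define \<Phi> where "\<Phi> t = Re (char \<mu>' t)" for t
  have \<Phi>: "continuous_on UNIV \<Phi>" "\<And>t. 0 \<le> \<Phi> t" "\<And>t. \<Phi> t \<le> 1"
    using range M'.isCont_char
    by (auto simp: \<Phi>_def intro!: continuous_at_imp_continuous_on continuous_intros)
  define P where "P m t = (1 - \<Phi> t) ^ Suc m" for m t
  have P: "continuous_on UNIV (P m)" "\<bar>P m t\<bar> \<le> 1" for m t
  proof -
    show "continuous_on UNIV (P m)" unfolding P_def by (intro continuous_intros \<Phi>(1))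
    show "\<bar>P m t\<bar> \<le> 1" unfolding P_def power_abs by (rule power_le_one) (use \<Phi>(2,3)[of t] in auto)
  qed
  obtain V where var: "\<And>m n t. incseq t \<Longrightarrow> 0 \<le> t 0 \<Longrightarrow> (\<Sum>i<n. \<bar>P m (t (Suc i)) - P m (t i)\<bar>) \<le> V"
    using variation_decon_power[OF real assms(5)] unfolding P_def \<Phi>_def by blast

  define S T where "S k = \<tau> (2 * k - 1)" and "T k = \<tau> (2 * k)" for k
  have pos: "0 < \<tau> k" if "k \<in> {1..2*K}" for k
    using assms(7)[OF that] M.char_zero by (cases "\<tau> k = 0") (auto simp: zero_ereal_def less_le)
  have odd_step: "\<tau> k \<le> \<tau> (k + 1)" "{\<tau> k..\<tau> (k + 1)} \<subseteq> char_zeros \<mu>" if "k \<in> {1..2*K}" "odd k" for k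
    using assms(8)[OF that] by simp_all
  have ST: "0 < S k" "S k \<le> T k" "{S k..T k} \<subseteq> char_zeros \<mu>" if "k \<in> {1..K}" for k
  proof -
    have k: "2 * k - 1 \<in> {1..2*K}" "odd (2 * k - 1)" "2 * k - 1 + 1 = 2 * k" using that by auto
    show "0 < S k" "S k \<le> T k" "{S k..T k} \<subseteq> char_zeros \<mu>"
      using pos[OF k(1)] odd_step[OF k(1,2)] unfolding S_def T_def k(3) .
  qed
  define Z where "Z = {t. \<Phi> t = 0}"
  have zero_iff: "ereal t \<in> char_zeros \<mu> \<longleftrightarrow> t \<in> Z" for t
    using real[of t] unfolding zeros[symmetric] char_zeros_ereal Z_def \<Phi>_def
    by (auto simp: complex_is_Real_iff complex_eq_iff)
  have [measurable]: "\<Phi> \<in> borel_measurable borel" by (rule borel_measurable_continuous_onI[OF \<Phi>(1)])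
  have Zm: "Z \<in> sets borel" unfolding Z_def by measurable
  have Z_sum: "indicator Z t = (\<Sum>k\<in>{1..K}. indicator {S k..T k} (ereal t) :: real)" if "0 < t" for t
  proof -
    have "indicator Z t = (indicator (char_zeros \<mu> \<inter> {0..\<infinity>}) (ereal t) :: real)"
      using that zero_iff[of t] by (simp add: indicator_def)
    also have "\<dots> = (\<Sum>k=1..K. indicator {S k..T k} (ereal t))"
      unfolding assms(10) S_def T_def
      by (rule interval_partition_indicator) (rule odd_step(1) assms(9), assumption+)+
    finally show ?thesis .
  qed

  define J where "J m w = signed_integral (convolution_power (dirac_minus \<mu>') (Suc m)) (\<lambda>x. sgn (w - x))" for m w
  \<comment> \<open>The limit of the sine integrals over the zero set of \<open>\<Phi>\<close>.\<close>
  define D where "D w = (\<Sum>k=1..K. Si_ext w (T k) - Si_ext w (S k))" for w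
  \<comment> \<open>The cut-offs \<open>1 / (n + 1)\<close> and \<open>n + 1\<close> are coupled, so one limit in \<open>n\<close> removes both.\<close>
  define a where "a n m w = (LINT t|haar_interval (1 / real (Suc n)) (real (Suc n)). sin (t * w) * P m t)" for n m w
  have a_J: "(\<lambda>n. a n m w) \<longlonglongrightarrow> pi / 2 * J m w" for m w
    unfolding a_def P_def \<Phi>_def J_def by (rule signed_integral_sgn_inversion[OF \<mu>' real])
  have J_lim: "(\<lambda>m. pi / 2 * J m w) \<longlonglongrightarrow> D w" for w
  proof (rule swap_uniformly_Cauchy_limits[of "\<lambda>n m. a n m w"])
    show "(\<lambda>m. a n m w) \<longlonglongrightarrow>
        (LINT t|haar_interval (1 / real (Suc n)) (real (Suc n)). sin (t * w) * indicator Z t)" for n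
      unfolding a_def P_def Z_def by (rule sine_integrals_of_powers_tendsto[OF \<Phi>]) simp
    show "(\<lambda>n. LINT t|haar_interval (1 / real (Suc n)) (real (Suc n)). sin (t * w) * indicator Z t) \<longlonglongrightarrow> D w"
      unfolding D_def by (rule Si_ext_combination_tendsto[OF Z_sum ST(1,2) Zm])
    show "\<exists>n0. \<forall>n\<ge>n0. \<forall>n'\<ge>n. \<forall>m. \<bar>a n' m w - a n m w\<bar> \<le> e" if "0 < e" for e
      unfolding a_def by (rule uniformly_Cauchy_sine_integrals[OF P var that])
  qed (rule a_J)
  obtain B where B: "\<And>x. \<bar>Si x\<bar> \<le> B" using bounded_Si by blast
  have J_bound: "\<bar>pi / 2 * J m w\<bar> \<le> 2 * B * (1 + V)" for m w
  proof (rule LIMSEQ_le_const2[OF tendsto_rabs[OF a_J]], intro exI allI impI)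
    fix n
    show "\<bar>a n m w\<bar> \<le> 2 * B * (1 + V)"
      unfolding a_def
    proof (rule abs_sine_integral_le_variation[OF _ _ P var])
      show "1 / real (Suc n) \<le> real (Suc n)"
        by (rule order_trans[of _ 1]) (simp_all add: divide_le_eq)
      show "\<bar>Si (w * c) - Si (w * (1 / real (Suc n)))\<bar> \<le> 2 * B" for c
        using B[of "w * c"] B[of "w * (1 / real (Suc n))"] by linarith
    qed simp
  qed
  have J_meas: "(\<lambda>z. pi / 2 * J m (\<xi> - z)) \<in> borel_measurable borel" for m \<xi>
  proof -
    obtain A C where d: "measure_difference (convolution_power (dirac_minus \<mu>') (Suc m)) A C"
      using convolution_power_measure_difference[OF M'.finite_borel_measure_M] by blast
    have "(\<lambda>(w, x). sgn (w - x)) \<in> borel_measurable (borel \<Otimes>\<^sub>M (borel :: real measure))" by measurable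
    then have "J m \<in> borel_measurable borel"
      unfolding J_def by (rule measurable_signed_integral[OF d, where B = 1]) (simp add: abs_sgn_eq)
    then show ?thesis by measurable
  qed
  have D_meas: "(\<lambda>z. D (\<xi> - z)) \<in> borel_measurable borel" for \<xi>
    by (rule borel_measurable_LIMSEQ_real[OF J_lim J_meas])
  have int_lim: "(\<lambda>m. LINT z|chi. pi / 2 * J m (\<xi> - z)) \<longlonglongrightarrow> (LINT z|chi. D (\<xi> - z))" for \<xi>
  proof (rule integral_dominated_convergence[where w = "\<lambda>_. 2 * B * (1 + V)"])
    show "AE z in chi. norm (pi / 2 * J m (\<xi> - z)) \<le> 2 * B * (1 + V)" for m
      using J_bound by (intro AE_I2) simp
    show "AE z in chi. (\<lambda>m. pi / 2 * J m (\<xi> - z)) \<longlonglongrightarrow> D (\<xi> - z)"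
      by (intro AE_I2 J_lim)
  qed (use D_meas J_meas in simp_all)

  have Psi_sum: "(\<Sum>k=1..K. fourier_Psi chi (\<tau> (2*k - 1)) (\<tau> (2*k)) (- \<xi>)) =
      complex_of_real (- (1 / pi) * (LINT z|chi. D (\<xi> - z)))" for \<xi>
  proof -
    obtain C where C: "\<And>w T. \<bar>Si_ext w T\<bar> \<le> C" using bounded_Si_ext by blast
    have "integrable chi (\<lambda>z. Si_ext (\<xi> - z) R)" for R
    proof (rule X.integrable_bounded)
      show "(\<lambda>z. Si_ext (\<xi> - z) R) \<in> borel_measurable borel"
        using measurable_Si_ext[of R] by measurable
      show "norm (Si_ext (\<xi> - z) R) \<le> C" for z using C by simp
    qed
    then have i: "integrable chi (\<lambda>z. Si_ext (\<xi> - z) (T k) - Si_ext (\<xi> - z) (S k))" for k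
      by (intro Bochner_Integration.integrable_diff)
    have "(\<Sum>k=1..K. fourier_Psi chi (\<tau> (2*k - 1)) (\<tau> (2*k)) (- \<xi>)) =
        (\<Sum>k=1..K. complex_of_real (- (1 / pi) * (LINT z|chi. Si_ext (\<xi> - z) (T k) - Si_ext (\<xi> - z) (S k))))"
      unfolding S_def[symmetric] T_def[symmetric]
      by (rule sum.cong[OF refl]) (rule fourier_Psi_Si_ext[OF chi ST(1,2)])
    also have "\<dots> = complex_of_real (- (1 / pi) *
        (\<Sum>k=1..K. LINT z|chi. Si_ext (\<xi> - z) (T k) - Si_ext (\<xi> - z) (S k)))"
      by (simp only: of_real_sum[symmetric] sum_distrib_left)
    also have "(\<Sum>k=1..K. LINT z|chi. Si_ext (\<xi> - z) (T k) - Si_ext (\<xi> - z) (S k)) =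
        (LINT z|chi. D (\<xi> - z))"
      unfolding D_def by (rule Bochner_Integration.integral_sum[symmetric]) (rule i)
    finally show ?thesis .
  qed
  have mid: "(deconvolution chi \<mu>' \<xi> m + left_limit (\<lambda>x. deconvolution chi \<mu>' x m) \<xi>) / 2 =
      (cdf chi \<xi> + left_limit (cdf chi) \<xi>) / 2 + - (1 / pi) * (LINT z|chi. pi / 2 * J m (\<xi> - z))" for \<xi> m
    unfolding deconvolution_midpoint[OF chi \<mu>'] J_def[symmetric] integral_mult_right_zero
    using pi_gt_zero by (simp only: mult_minus_left times_divide_eq_left) simp
  show ?thesis
  proof (intro conjI allI impI)
    fix \<xi>
    show "(\<lambda>m. complex_of_real
              ((deconvolution chi \<mu>' \<xi> m + left_limit (\<lambda>x. deconvolution chi \<mu>' x m) \<xi>) / 2))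
            \<longlonglongrightarrow> complex_of_real ((cdf chi \<xi> + left_limit (cdf chi) \<xi>) / 2)
              + (\<Sum>k=1..K. fourier_Psi chi (\<tau> (2*k - 1)) (\<tau> (2*k)) (- \<xi>))"
      unfolding mid Psi_sum of_real_add[symmetric]
      by (intro tendsto_of_real tendsto_add tendsto_mult tendsto_const int_lim)
  next
    fix \<xi> assume null: "emeasure lborel {t. ereal t \<in> char_zeros \<mu>} = 0"
    have "{t. ereal t \<in> char_zeros \<mu>} \<in> sets borel" using Zm by (simp only: zero_iff Collect_mem_eq)
    note ends = null_interval_endpoints_eq[OF null this ST(3,1,2)]
    have D0: "D w = 0" for w
      unfolding D_def
    proof (rule sum.neutral, rule ballI)
      fix k assume k: "k \<in> {1..K}"
      show "Si_ext w (T k) - Si_ext w (S k) = 0"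
        unfolding ends[OF k k k] by (rule diff_self)
    qed
    show "(\<Sum>k=1..K. fourier_Psi chi (\<tau> (2*k - 1)) (\<tau> (2*k)) (- \<xi>)) = 0"
      unfolding Psi_sum D0 by simp
  qed
qed

end
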